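(* Let $\Gamma=(S,R)$ be a finite tree with a perfect matching $\mathcal P$, and let $xy\in R$ be an edge. Let $\widehat\Gamma$ be the tree obtained from $\Gamma$ by inserting a new vertex $z$ on the edge $xy$ (i.e. vertex set $S\cup\{z\}$ and edge set $(R\setminus\{xy\})\cup\{xz,yz\}$). If $xy$ is of odd type, then $\widehat\Gamma$ is $1$-lit; if $xy$ is of even type, then $\widehat\Gamma$ is $2$-lit.
   Context: Lit-only $\sigma$-game: for a finite simple graph, a configuration assigns on or off to every vertex; a move chooses an on vertex $s$ and changes the states of all neighbors of $s$. A graph is $k$-lit if for every configuration the number of on vertices can be reduced to at most $k$ by a finite sequence of moves. An alternating path in $\Gamma$ (with respect to $\mathcal P$) is a path whose edges belong alternately to $\mathcal P$ and not to $\mathcal P$. For $s\in S$, let $A_s$ be the set of vertices $t\in S\setminus\{s\}$ such that the path in $\Gamma$ joining $s$ and $t$ is an alternating path whose first edge (the one at $s$) and last edge (the one at $t$) both belong to $\mathcal P$; set $a_s=|A_s|$. An edge $st\in R$ is of odd type if $a_s+a_t$ is odd and of even type if $a_s+a_t$ is even. *)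

theory Defs
  imports Main
begin

text \<open>A graph is given by its vertex set \<open>S\<close> and its set \<open>R\<close> of edges, an edge joining
  \<open>u\<close> and \<open>v\<close> being the two-element set \<open>{u, v}\<close>. A path is the list of its vertices.\<close>

definition finite_simple_graph :: "'a set \<Rightarrow> 'a set set \<Rightarrow> bool" where
  "finite_simple_graph S R \<longleftrightarrow> finite S \<and> (\<forall>e\<in>R. e \<subseteq> S \<and> card e = 2)"

fun path_edges :: "'a list \<Rightarrow> 'a set list" where
  "path_edges (u # v # p) = {u, v} # path_edges (v # p)"
| "path_edges _ = []"

definition joining_path :: "'a set \<Rightarrow> 'a set set \<Rightarrow> 'a \<Rightarrow> 'a list \<Rightarrow> 'a \<Rightarrow> bool" where
  "joining_path S R u p v \<longleftrightarrow>
     p \<noteq> [] \<and> hd p = u \<and> last p = v \<and> distinct p \<and> set p \<subseteq> S \<and> set (path_edges p) \<subseteq> R"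

text \<open>A cycle is listed without repeating its starting vertex at the end.\<close>

definition graph_cycle :: "'a set \<Rightarrow> 'a set set \<Rightarrow> 'a list \<Rightarrow> bool" where
  "graph_cycle S R c \<longleftrightarrow>
     length c \<ge> 3 \<and> distinct c \<and> set c \<subseteq> S \<and> set (path_edges (c @ [hd c])) \<subseteq> R"

definition finite_tree :: "'a set \<Rightarrow> 'a set set \<Rightarrow> bool" where
  "finite_tree S R \<longleftrightarrow> finite_simple_graph S R \<and> S \<noteq> {} \<and>
     (\<forall>u\<in>S. \<forall>v\<in>S. \<exists>p. joining_path S R u p v) \<and> \<not> (\<exists>c. graph_cycle S R c)"

definition perfect_matching :: "'a set \<Rightarrow> 'a set set \<Rightarrow> 'a set set \<Rightarrow> bool" where
  "perfect_matching S R P \<longleftrightarrow> P \<subseteq> R \<and> (\<forall>v\<in>S. \<exists>!e. e \<in> P \<and> v \<in> e)"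

definition alternating :: "'a set set \<Rightarrow> 'a list \<Rightarrow> bool" where
  "alternating P p \<longleftrightarrow>
     (\<forall>i. Suc i < length (path_edges p) \<longrightarrow>
        (path_edges p ! i \<in> P \<longleftrightarrow> path_edges p ! Suc i \<notin> P))"

text \<open>The set \<open>A\<^sub>s\<close> of a tree. The path joining \<open>s\<close> and \<open>t\<close> is unique, and it has at least one
  edge because \<open>t \<noteq> s\<close>; it may consist of a single edge of \<open>P\<close>.\<close>

definition alt_set :: "'a set \<Rightarrow> 'a set set \<Rightarrow> 'a set set \<Rightarrow> 'a \<Rightarrow> 'a set" where
  "alt_set S R P s = {t \<in> S - {s}. \<exists>p. joining_path S R s p t \<and> alternating P p \<and>
     hd (path_edges p) \<in> P \<and> last (path_edges p) \<in> P}"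

definition odd_type :: "'a set \<Rightarrow> 'a set set \<Rightarrow> 'a set set \<Rightarrow> 'a \<Rightarrow> 'a \<Rightarrow> bool" where
  "odd_type S R P s t \<longleftrightarrow> odd (card (alt_set S R P s) + card (alt_set S R P t))"

definition even_type :: "'a set \<Rightarrow> 'a set set \<Rightarrow> 'a set set \<Rightarrow> 'a \<Rightarrow> 'a \<Rightarrow> bool" where
  "even_type S R P s t \<longleftrightarrow> even (card (alt_set S R P s) + card (alt_set S R P t))"

definition neighbors :: "'a set \<Rightarrow> 'a set set \<Rightarrow> 'a \<Rightarrow> 'a set" where
  "neighbors S R s = {t \<in> S. {s, t} \<in> R}"

text \<open>A configuration of the lit-only \<open>\<sigma>\<close>-game is identified with its set of on vertices, so a
  move at an on vertex is a symmetric difference with the neighborhood of that vertex.\<close>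

definition lit_move :: "'a set \<Rightarrow> 'a set set \<Rightarrow> 'a set \<Rightarrow> 'a set \<Rightarrow> bool" where
  "lit_move S R C D \<longleftrightarrow> (\<exists>s\<in>C. D = sym_diff C (neighbors S R s))"

definition k_lit :: "nat \<Rightarrow> 'a set \<Rightarrow> 'a set set \<Rightarrow> bool" where
  "k_lit k S R \<longleftrightarrow> (\<forall>C. C \<subseteq> S \<longrightarrow> (\<exists>D. (lit_move S R)\<^sup>*\<^sup>* C D \<and> card D \<le> k))"

end

theory Submission
  imports Defs "HOL-Library.Z2" "HOL-Library.Function_Algebras"
begin

text \<open>Configurations are linear functionals on the space of vectors over the field with two elements that are
  indexed by the vertices. This space carries the adjacency form \<open>B\<close> and the quadratic form \<open>Q\<close> that has
  polar form \<open>B\<close> and is 1 on the standard basis. A move adds \<open>B d\<close> to a functional that is 1 on \<open>d\<close>, for a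
  basis vector \<open>d\<close>, and the same is then possible for every \<open>d\<close> in the closure of the basis under adding
  pairs with \<open>B u v = 1\<close>.

  The space of the subdivided tree is the orthogonal sum of a copy \<open>V\<close> of the nondegenerate space of the
  original tree and of the line of the radical. If the tree is not a path, then it contains \<open>E\<^sub>6\<close> and grows
  from there by attaching matching edges; in each step the closure remains the set of all vectors of \<open>V\<close>
  with \<open>Q = 1\<close>, so that two nonzero elements of \<open>V\<close> with the same value of \<open>Q\<close> are in one orbit. The
  move at \<open>z\<close> joins some of these orbits. The dual basis of \<open>V\<close> consists of the sums over the sets
  \<open>A\<^sub>s\<close>, so the parities of the \<open>a\<^sub>s\<close> decide which orbits contain a configuration with one light.
  If the tree is a path, then the game is a sorting problem.\<close>

section \<open>Quadratic forms over the field with two elements\<close>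

text \<open>Bits are encoded as truth values, so addition is \<open>\<noteq>\<close>. With
  \<open>double\<close> the group is a vector space over the field with two elements and additivity
  is linearity. \<open>D_add\<close> is closure of \<open>D\<close> under the transvections in its
  own elements.\<close>

locale f2_quadratic =
  fixes B :: "'v::ab_group_add \<Rightarrow> 'v \<Rightarrow> bool" and Q :: "'v \<Rightarrow> bool" and D :: "'v set"
  assumes double [simp]: "v + v = (0::'v)"
    and B_add: "B (u + v) w \<longleftrightarrow> (B u w \<noteq> B v w)"
    and B_sym: "B u v \<longleftrightarrow> B v u"
    and Q_add: "Q (u + v) \<longleftrightarrow> ((Q u \<noteq> Q v) \<noteq> B u v)"
    and D_add: "u \<in> D \<Longrightarrow> v \<in> D \<Longrightarrow> B u v \<Longrightarrow> u + v \<in> D"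
begin

lemma double_left [simp]: "v + (v + w) = (w::'v)"
  by (simp add: add.assoc[symmetric])

lemma add_eq_0_iff_eq: "u + v = (0::'v) \<longleftrightarrow> u = v"
  by (metis add_right_cancel double)

lemma B_symD: "\<not> B u v \<Longrightarrow> \<not> B v u"
  using B_sym by blast

lemma B_add_right: "B w (u + v) \<longleftrightarrow> (B w u \<noteq> B w v)"
  using B_add B_sym by blast

lemma B_0 [simp]: "\<not> B 0 v" "\<not> B v 0"
  using B_add[of 0 0 v] B_sym[of v 0] by auto

lemma Q_0 [simp]: "\<not> Q 0"
  using Q_add[of 0 0] by auto

lemma B_self [simp]: "\<not> B v v"
  using Q_add[of v v] by auto

lemma B_sum:
  assumes "finite A"
  shows "B (\<Sum>a\<in>A. f a) v \<longleftrightarrow> odd (card {a \<in> A. B (f a) v})"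
  using assms
proof induction
  case (insert a A)
  have "{b \<in> insert a A. B (f b) v} = (if B (f a) v then {a} else {}) \<union> {b \<in> A. B (f b) v}"
    by auto
  then show ?case
    using insert by (simp add: B_add)
qed simp

lemma Q_sum:
  assumes "finite A" "\<And>a b. a \<in> A \<Longrightarrow> b \<in> A \<Longrightarrow> \<not> B (f a) (f b)" "\<And>a. a \<in> A \<Longrightarrow> Q (f a)"
  shows "Q (\<Sum>a\<in>A. f a) \<longleftrightarrow> odd (card A)"
  using assms
proof induction
  case (insert a A)
  have *: "{b \<in> A. B (f b) (f a)} = {}"
    using insert.prems(1) by blast
  have "\<not> B (\<Sum>b\<in>A. f b) (f a)"
    unfolding B_sum[OF insert(1)] * by simp
  then show ?case
    using insert B_sym[of "f a" "sum f A"] by (simp add: Q_add)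
qed simp

section \<open>Subspaces, duality and orthogonal planes\<close>

definition subspace :: "'v set \<Rightarrow> bool" where
  "subspace V \<longleftrightarrow> 0 \<in> V \<and> (\<forall>u\<in>V. \<forall>v\<in>V. u + v \<in> V)"

definition additive_on :: "'v set \<Rightarrow> ('v \<Rightarrow> bool) \<Rightarrow> bool" where
  "additive_on V f \<longleftrightarrow> (\<forall>u\<in>V. \<forall>v\<in>V. f (u + v) \<longleftrightarrow> (f u \<noteq> f v))"

definition nondegenerate :: "'v set \<Rightarrow> bool" where
  "nondegenerate V \<longleftrightarrow> (\<forall>v\<in>V. v \<noteq> 0 \<longrightarrow> (\<exists>w\<in>V. B v w))"

text \<open>For finite \<open>V\<close> this is equivalent to nondegeneracy. Carrying both
  properties through the induction replaces an argument with dimensions.\<close>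

definition self_dual :: "'v set \<Rightarrow> bool" where
  "self_dual V \<longleftrightarrow> (\<forall>f. additive_on V f \<longrightarrow> (\<exists>w\<in>V. \<forall>v\<in>V. f v \<longleftrightarrow> B w v))"

text \<open>Two mutually orthogonal hyperbolic planes: a lower bound for the rank of
  \<open>B\<close> on \<open>V\<close>, stated through witnesses.\<close>

definition two_planes :: "'v set \<Rightarrow> bool" where
  "two_planes V \<longleftrightarrow> (\<exists>e\<^sub>1\<in>V. \<exists>f\<^sub>1\<in>V. \<exists>e\<^sub>2\<in>V. \<exists>f\<^sub>2\<in>V. B e\<^sub>1 f\<^sub>1 \<and> B e\<^sub>2 f\<^sub>2 \<and>
     \<not> B e\<^sub>1 e\<^sub>2 \<and> \<not> B e\<^sub>1 f\<^sub>2 \<and> \<not> B f\<^sub>1 e\<^sub>2 \<and> \<not> B f\<^sub>1 f\<^sub>2)"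

definition three_planes :: "'v set \<Rightarrow> bool" where
  "three_planes V \<longleftrightarrow> (\<exists>e\<^sub>1\<in>V. \<exists>f\<^sub>1\<in>V. \<exists>e\<^sub>2\<in>V. \<exists>f\<^sub>2\<in>V. \<exists>e\<^sub>3\<in>V. \<exists>f\<^sub>3\<in>V.
     B e\<^sub>1 f\<^sub>1 \<and> B e\<^sub>2 f\<^sub>2 \<and> B e\<^sub>3 f\<^sub>3 \<and>
     \<not> B e\<^sub>1 e\<^sub>2 \<and> \<not> B e\<^sub>1 f\<^sub>2 \<and> \<not> B f\<^sub>1 e\<^sub>2 \<and> \<not> B f\<^sub>1 f\<^sub>2 \<and>
     \<not> B e\<^sub>1 e\<^sub>3 \<and> \<not> B e\<^sub>1 f\<^sub>3 \<and> \<not> B f\<^sub>1 e\<^sub>3 \<and> \<not> B f\<^sub>1 f\<^sub>3 \<and>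
     \<not> B e\<^sub>2 e\<^sub>3 \<and> \<not> B e\<^sub>2 f\<^sub>3 \<and> \<not> B f\<^sub>2 e\<^sub>3 \<and> \<not> B f\<^sub>2 f\<^sub>3)"

lemma subspace_add: "subspace V \<Longrightarrow> u \<in> V \<Longrightarrow> v \<in> V \<Longrightarrow> u + v \<in> V"
  by (simp add: subspace_def)

lemma additive_on_B: "additive_on V (B v)"
  by (auto simp: additive_on_def B_add_right)

lemma subspace_perp: "subspace V \<Longrightarrow> subspace {u \<in> V. \<not> B v u}"
  by (auto simp: subspace_def B_add_right)

text \<open>A linear functional on a plane vanishes on some nonzero vector, and any two distinct
  nonzero vectors of the plane pair to 1. Keeping \<open>h\<close> and \<open>k\<close> among the
  vectors of the plane preserves orthogonality to other planes.\<close>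

lemma plane_basis:
  assumes V: "subspace V" "additive_on V \<phi>" and ef: "e \<in> V" "f \<in> V" "B e f"
  obtains h k where "h \<in> V" "k \<in> V" "B h k" "\<not> \<phi> h"
    "h \<in> {e, f, e + f}" "k \<in> {e, f, e + f}"
proof -
  have "\<phi> (e + f) \<longleftrightarrow> (\<phi> e \<noteq> \<phi> f)"
    using V ef by (auto simp: additive_on_def)
  then consider "\<not> \<phi> e" | "\<not> \<phi> f" | "\<not> \<phi> (e + f)"
    by blast
  then show thesis
  proof cases
    case 1 then show thesis using that[of e f] ef by simp
  next
    case 2 then show thesis using that[of f e] ef B_sym[of f e] by simp
  next
    case 3 then show thesis
      using that[of "e + f" f] ef subspace_add[OF V(1)] by (auto simp: B_add B_add_right)
  qed
qed

text \<open>In each plane choose a basis \<open>h, k\<close> with \<open>h\<close> orthogonal to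
  \<open>v\<close>. Vectors \<open>k\<close> that fail to be orthogonal to \<open>v\<close> become
  so after adding two of them from different planes, and this costs at most one plane.\<close>

lemma three_planes_perp:
  assumes V: "subspace V" and "three_planes V"
  shows "two_planes {u \<in> V. \<not> B v u}"
proof -
  let ?X = "{u \<in> V. \<not> B v u}"
  obtain e1 f1 e2 f2 e3 f3 where V6: "e1 \<in> V" "f1 \<in> V" "e2 \<in> V" "f2 \<in> V" "e3 \<in> V" "f3 \<in> V"
    and b: "B e1 f1" "B e2 f2" "B e3 f3"
     "\<not> B e1 e2" "\<not> B e1 f2" "\<not> B f1 e2" "\<not> B f1 f2"
     "\<not> B e1 e3" "\<not> B e1 f3" "\<not> B f1 e3" "\<not> B f1 f3"
     "\<not> B e2 e3" "\<not> B e2 f3" "\<not> B f2 e3" "\<not> B f2 f3"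
    using assms(2) unfolding three_planes_def by blast
  note nb = plane_basis[OF V additive_on_B[of V v]]
  obtain h1 k1 where p1: "h1 \<in> V" "k1 \<in> V" "B h1 k1" "\<not> B v h1"
    and m1: "h1 \<in> {e1, f1, e1 + f1}" "k1 \<in> {e1, f1, e1 + f1}"
    by (rule nb[OF V6(1,2) b(1)])
  obtain h2 k2 where p2: "h2 \<in> V" "k2 \<in> V" "B h2 k2" "\<not> B v h2"
    and m2: "h2 \<in> {e2, f2, e2 + f2}" "k2 \<in> {e2, f2, e2 + f2}"
    by (rule nb[OF V6(3,4) b(2)])
  obtain h3 k3 where p3: "h3 \<in> V" "k3 \<in> V" "B h3 k3" "\<not> B v h3"
    and m3: "h3 \<in> {e3, f3, e3 + f3}" "k3 \<in> {e3, f3, e3 + f3}"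
    by (rule nb[OF V6(5,6) b(3)])
  have c12: "\<not> B h1 h2" "\<not> B h1 k2" "\<not> B k1 h2" "\<not> B k1 k2"
    using m1 m2 b by (auto simp: B_add B_add_right)
  have c13: "\<not> B h1 h3" "\<not> B h1 k3" "\<not> B k1 h3" "\<not> B k1 k3"
    using m1 m3 b by (auto simp: B_add B_add_right)
  have c23: "\<not> B h2 h3" "\<not> B h2 k3" "\<not> B k2 h3" "\<not> B k2 k3"
    using m2 m3 b by (auto simp: B_add B_add_right)
  note c = c12 c13 c23 c12[THEN B_symD] c13[THEN B_symD] c23[THEN B_symD]
  have two: "two_planes ?X" if "h \<in> ?X" "k \<in> ?X" "h' \<in> ?X" "k' \<in> ?X" "B h k" "B h' k'"
    "\<not> B h h'" "\<not> B h k'" "\<not> B k h'" "\<not> B k k'" for h k h' k'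
    unfolding two_planes_def using that by blast
  note add = subspace_add[OF V] B_add B_add_right
  consider "\<not> B v k1" "\<not> B v k2" | "\<not> B v k1" "\<not> B v k3" | "\<not> B v k2" "\<not> B v k3"
    | "\<not> B v k1" "B v k2" "B v k3" | "B v k1" "\<not> B v k2" "B v k3" | "B v k1" "B v k2" "\<not> B v k3"
    | "B v k1" "B v k2" "B v k3"
    by blast
  then show ?thesis
  proof cases
    case 1 then show ?thesis using two[of h1 k1 h2 k2] p1 p2 p3 c by (simp add: add)
  next
    case 2 then show ?thesis using two[of h1 k1 h3 k3] p1 p2 p3 c by (simp add: add)
  next
    case 3 then show ?thesis using two[of h2 k2 h3 k3] p1 p2 p3 c by (simp add: add)
  next
    case 4 then show ?thesis using two[of h1 k1 h2 "k2 + k3"] p1 p2 p3 c by (simp add: add)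
  next
    case 5 then show ?thesis using two[of h2 k2 h1 "k1 + k3"] p1 p2 p3 c by (simp add: add)
  next
    case 6 then show ?thesis using two[of h3 k3 h1 "k1 + k2"] p1 p2 p3 c by (simp add: add)
  next
    case 7 then show ?thesis using two[of h1 "k1 + k3" h2 "k2 + k3"] p1 p2 p3 c by (simp add: add)
  qed
qed

lemma two_planes_perp:
  assumes V: "subspace V" and "two_planes V"
  shows "\<exists>e\<in>V. \<exists>f\<in>V. B e f \<and> \<not> B v e \<and> \<not> B v f"
proof -
  obtain e1 f1 e2 f2 where V4: "e1 \<in> V" "f1 \<in> V" "e2 \<in> V" "f2 \<in> V"
    and b: "B e1 f1" "B e2 f2" "\<not> B e1 e2" "\<not> B e1 f2" "\<not> B f1 e2" "\<not> B f1 f2"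
    using assms(2) unfolding two_planes_def by blast
  note nb = plane_basis[OF V additive_on_B[of V v]]
  obtain h1 k1 where p1: "h1 \<in> V" "k1 \<in> V" "B h1 k1" "\<not> B v h1"
    and m1: "h1 \<in> {e1, f1, e1 + f1}" "k1 \<in> {e1, f1, e1 + f1}"
    by (rule nb[OF V4(1,2) b(1)])
  obtain h2 k2 where p2: "h2 \<in> V" "k2 \<in> V" "B h2 k2" "\<not> B v h2"
    and m2: "h2 \<in> {e2, f2, e2 + f2}" "k2 \<in> {e2, f2, e2 + f2}"
    by (rule nb[OF V4(3,4) b(2)])
  have "\<not> B h1 k2"
    using m1 m2 b by (auto simp: B_add B_add_right)
  then have "B h1 (k1 + k2)"
    using p1 by (simp add: B_add_right)
  show ?thesis
  proof (cases "B v k1 \<and> B v k2")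
    case True
    then show ?thesis
      using p1 p2 \<open>B h1 (k1 + k2)\<close> subspace_add[OF V \<open>k1 \<in> V\<close> \<open>k2 \<in> V\<close>]
      by (intro bexI[of _ h1] bexI[of _ "k1 + k2"]) (auto simp: B_add_right)
  next
    case False
    then show ?thesis
      using p1 p2 by blast
  qed
qed

text \<open>Two planes remain orthogonal to \<open>v\<close>. A plane takes the value 1 on some
  nonzero vector; if it takes only this value, adding a vector with \<open>Q\<close> equal to 1 from
  the second plane gives 0.\<close>

lemma perp_both_values:
  assumes V: "subspace V" "three_planes V"
  shows "\<exists>w\<in>V. w \<noteq> 0 \<and> w \<noteq> v \<and> \<not> B v w \<and> Q w = c"
proof -
  obtain e1 f1 e2 f2 where V4: "e1 \<in> V" "f1 \<in> V" "e2 \<in> V" "f2 \<in> V"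
    and v: "\<not> B v e1" "\<not> B v f1" "\<not> B v e2" "\<not> B v f2"
    and b: "B e1 f1" "B e2 f2" "\<not> B e1 e2" "\<not> B e1 f2" "\<not> B f1 e2" "\<not> B f1 f2"
    using three_planes_perp[OF V, of v] unfolding two_planes_def by auto
  \<comment> \<open>Since \<open>v\<close> is orthogonal to the first plane, a vector that is not
    cannot be 0 or \<open>v\<close>.\<close>
  have ok: "w \<noteq> 0 \<and> w \<noteq> v \<and> \<not> B v w" if "B w e1 \<or> B w f1" "\<not> B v w" for w
    using that v by auto
  have "\<exists>w\<in>{e1, f1, e1 + f1, e1 + e2, e1 + f2, e1 + (e2 + f2)}. Q w = c"
    using b by (cases c) (auto simp: Q_add B_add_right)
  then obtain w where w: "w \<in> {e1, f1, e1 + f1, e1 + e2, e1 + f2, e1 + (e2 + f2)}" "Q w = c"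
    by blast
  have "w \<in> V"
    using w(1) V4 subspace_add[OF V(1)] by auto
  moreover have "\<not> B v w"
    using w(1) v by (auto simp: B_add_right)
  moreover have "B w e1 \<or> B w f1"
    using w(1) b B_sym[of f1 e1] B_sym[of e2 f1] B_sym[of f2 f1] by (auto simp: B_add)
  ultimately show ?thesis
    using ok w(2) by blast
qed

text \<open>First some \<open>t\<close> pairs to 1 with both vectors, if need be as the sum of a
  witness for each. A plane orthogonal to both vectors then adjusts \<open>Q t\<close> without
  changing these pairings.\<close>

lemma common_neighbor:
  assumes V: "subspace V" "three_planes V" "nondegenerate V"
    and vw: "v \<in> V" "w \<in> V" "v \<noteq> 0" "w \<noteq> 0"
  shows "\<exists>t\<in>V. B v t \<and> B w t \<and> Q t = c"
proof -
  obtain a b where ab: "a \<in> V" "b \<in> V" "B v a" "B w b"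
    using V(3) vw unfolding nondegenerate_def by blast
  obtain t where t: "t \<in> V" "B v t" "B w t"
  proof (cases "B w a \<or> B v b")
    case True then show thesis using that ab by blast
  next
    case False then show thesis
      using that[of "a + b"] ab subspace_add[OF V(1)] by (simp add: B_add_right)
  qed
  obtain e f where ef: "e \<in> V" "f \<in> V" "B e f" "\<not> B v e" "\<not> B v f" "\<not> B w e" "\<not> B w f"
    using two_planes_perp[OF subspace_perp[OF V(1)] three_planes_perp[OF V(1,2)], of v w] by blast
  \<comment> \<open>As a function of \<open>h\<close> in the plane, \<open>Q (t + h) + Q t\<close>
    is a quadratic form with the same polar form, so it takes both values.\<close>
  have "\<exists>s\<in>{t, t + e, t + f, t + (e + f)}. Q s = c"
    using ef(3) by (cases c) (auto simp: Q_add B_add_right)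
  then obtain s where s: "s \<in> {t, t + e, t + f, t + (e + f)}" "Q s = c"
    by blast
  then have "s \<in> V" "B v s" "B w s"
    using t ef subspace_add[OF V(1)] by (auto simp: B_add_right)
  then show ?thesis
    using s(2) by blast
qed

text \<open>Transitivity of the transvections in vectors with \<open>Q\<close> equal to 1, stated as
  an induction rule. Two steps suffice, through a common neighbor with the same value of
  \<open>Q\<close>: if \<open>Q u = Q s\<close> and \<open>B u s\<close>, then
  \<open>Q (u + s)\<close> is 1 and the transvection in \<open>u + s\<close> maps \<open>u\<close>
  to \<open>s\<close>.\<close>

lemma orbit_induct:
  assumes V: "subspace V" "three_planes V" "nondegenerate V"
    and vw: "v \<in> V" "w \<in> V" "v \<noteq> 0" "w \<noteq> 0" "Q v = Q w"
    and P: "P v" "\<And>u d. u \<in> V \<Longrightarrow> d \<in> V \<Longrightarrow> Q d \<Longrightarrow> B u d \<Longrightarrow> P u \<Longrightarrow> P (u + d)"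
  shows "P w"
proof -
  have step: "P s" if "u \<in> V" "s \<in> V" "Q u = Q s" "B u s" "P u" for u s
    using P(2)[of u "u + s"] that subspace_add[OF V(1)] by (simp add: Q_add B_add_right)
  obtain t where "t \<in> V" "B v t" "B w t" "Q t = Q v"
    using common_neighbor[OF V vw(1-4)] by blast
  then show ?thesis
    using step[of v t] step[of t w] vw P(1) B_sym by blast
qed

section \<open>Spans and their extension by a plane\<close>

inductive_set span :: "'v set \<Rightarrow> 'v set" for G where
  span_0: "0 \<in> span G"
| span_add_base: "g \<in> G \<Longrightarrow> v \<in> span G \<Longrightarrow> g + v \<in> span G"

lemma subspace_span: "subspace (span G)"
proof -
  have "u + v \<in> span G" if "u \<in> span G" "v \<in> span G" for u v
    using that by (induction u) (auto simp: add.assoc intro: span.intros)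
  then show ?thesis
    by (auto simp: subspace_def intro: span_0)
qed

lemma span_base: "g \<in> G \<Longrightarrow> g \<in> span G"
  using span_add_base[OF _ span_0] by force

lemma span_mono:
  assumes "G \<subseteq> H"
  shows "span G \<subseteq> span H"
proof
  show "v \<in> span H" if "v \<in> span G" for v
    using that assms by induction (auto intro: span.intros)
qed

lemma span_empty [simp]: "span {} = {0}"
proof -
  have "v = 0" if "v \<in> span {}" for v
    using that by induction auto
  then show ?thesis
    by (auto intro: span_0)
qed

lemma span_insertE:
  assumes "v \<in> span (insert g G)"
  obtains "v \<in> span G" | w where "w \<in> span G" "v = w + g"
proof -
  have "v \<in> span G \<or> v + g \<in> span G"
    using assms
  proof induction
    case span_0 then show ?case by (simp add: span.span_0)
  next
    case (span_add_base h v)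
    then show ?case
      using span.span_add_base[of h G v] span.span_add_base[of h G "v + g"] by (auto simp: add_ac)
  qed
  then show thesis
    using that by (metis add.assoc add.right_neutral double)
qed

lemma B_span_cong:
  assumes "v \<in> span G" "\<And>g. g \<in> G \<Longrightarrow> B u g \<longleftrightarrow> B w g"
  shows "B u v \<longleftrightarrow> B w v"
  using assms(1) by induction (auto simp: B_add_right assms(2))

text \<open>Although \<open>p\<close> may pair with the old span, correcting it by a vector of that
  span makes it orthogonal. The new span is then the orthogonal sum of the old one and a hyperbolic
  plane.\<close>

lemma plane_extension:
  assumes V: "nondegenerate (span G)" "self_dual (span G)"
    and pq: "B p q" "\<And>v. v \<in> span G \<Longrightarrow> \<not> B q v"
  shows "nondegenerate (span (insert p (insert q G)))" (is "nondegenerate ?W")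
    and "self_dual (span (insert p (insert q G)))"
proof -
  let ?V = "span G"
  obtain \<omega> where \<omega>: "\<omega> \<in> ?V" "\<And>v. v \<in> ?V \<Longrightarrow> B p v \<longleftrightarrow> B \<omega> v"
    using V(2) additive_on_B[of ?V p] unfolding self_dual_def by blast
  \<comment> \<open>\<omega> represents \<open>B p\<close> on the old span, so \<open>r\<close> is
    orthogonal to it, and still \<open>B r q\<close>.\<close>
  define r where "r = p + \<omega>"
  have r: "\<not> B r v" "\<not> B v r" "\<not> B v q" if "v \<in> ?V" for v
    using \<omega>(2)[OF that] pq(2)[OF that] B_sym[of v r] B_sym[of v q] by (auto simp: r_def B_add)
  have rq: "B r q" "B q r"
    using pq(1) r(3)[OF \<omega>(1)] B_sym[of r q] by (auto simp: r_def B_add)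
  have VW: "?V \<subseteq> ?W"
    by (intro span_mono) auto
  have qW: "q \<in> ?W" and "p \<in> ?W"
    by (auto intro: span_base)
  then have rW: "r \<in> ?W"
    unfolding r_def using subspace_add[OF subspace_span] VW \<omega>(1) by blast
  have cases: "\<exists>v\<in>?V. u \<in> {v, v + q, v + r, v + (q + r)}" if "u \<in> ?W" for u
  proof -
    have sub: "v + \<omega> \<in> ?V" if "v \<in> ?V" for v
      using that \<omega>(1) subspace_add[OF subspace_span] by blast
    have p: "p = \<omega> + r"
      by (simp add: r_def add_ac)
    from \<open>u \<in> ?W\<close> show ?thesis
    proof (cases rule: span_insertE)
      case 1 then show ?thesis by (cases rule: span_insertE) auto
    next
      case (2 w)
      from 2(1) show ?thesis
      proof (cases rule: span_insertE)
        case 1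
        then show ?thesis
          using 2(2) sub[OF 1] by (auto simp: p add_ac)
      next
        case (2 w')
        then have "u = (w' + \<omega>) + (q + r)"
          using \<open>u = w + p\<close> by (simp add: p add_ac)
        then show ?thesis
          using sub[OF 2(1)] by blast
      qed
    qed
  qed
  show "nondegenerate ?W"
    unfolding nondegenerate_def
  proof (intro ballI impI)
    fix u assume u: "u \<in> ?W" "u \<noteq> 0"
    obtain v where v: "v \<in> ?V" "u \<in> {v, v + q, v + r, v + (q + r)}"
      using cases[OF u(1)] by blast
    have "B u q \<or> B u r \<or> u = v"
      using v(2) r[OF v(1)] rq by (auto simp: B_add)
    then show "\<exists>w\<in>?W. B u w"
      using qW rW VW V(1) u(2) v(1) unfolding nondegenerate_def by blast
  qed
  show "self_dual ?W"
    unfolding self_dual_def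
  proof (intro allI impI)
    fix f assume f: "additive_on ?W f"
    then have "additive_on ?V f"
      using VW by (auto simp: additive_on_def)
    then obtain t where t: "t \<in> ?V" "\<And>v. v \<in> ?V \<Longrightarrow> f v \<longleftrightarrow> B t v"
      using V(2) unfolding self_dual_def by blast
    \<comment> \<open>The values at \<open>q\<close> and \<open>r\<close> appear as coefficients of
      the opposite vector because \<open>B r q\<close> is the only nonzero pairing in this
      plane.\<close>
    define w where "w = t + ((if f q then r else 0) + (if f r then q else 0))"
    have add: "f (x + y) \<longleftrightarrow> (f x \<noteq> f y)" "x + y \<in> ?W" if "x \<in> ?W" "y \<in> ?W" for x y
      using f that subspace_add[OF subspace_span] by (auto simp: additive_on_def)
    have "f u \<longleftrightarrow> B w u" if u: "u \<in> ?W" for u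
    proof -
      obtain v where v: "v \<in> ?V" "u \<in> {v, v + q, v + r, v + (q + r)}"
        using cases[OF u] by blast
      have "f v \<longleftrightarrow> B w v"
        using t(2)[OF v(1)] r[OF v(1)] pq(2)[OF v(1)] by (auto simp: w_def B_add)
      moreover have "f q \<longleftrightarrow> B w q" "f r \<longleftrightarrow> B w r"
        using r[OF t(1)] rq by (auto simp: w_def B_add)
      moreover have "v \<in> ?W"
        using v(1) VW by blast
      ultimately show ?thesis
        using v(2) by (auto simp: add qW rW B_add_right)
    qed
    moreover have "w \<in> ?W"
      unfolding w_def using t(1) VW qW rW add(2) span_0 by auto
    ultimately show "\<exists>w\<in>?W. \<forall>v\<in>?W. f v \<longleftrightarrow> B w v"
      by blast
  qed
qed

text \<open>Every vector of the extension is \<open>v + h\<close> with \<open>v\<close> in the old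
  span and \<open>h\<close> in the plane of \<open>q\<close> and \<open>r = p + \<omega>\<close>.
  The vectors \<open>v + r\<close> come from \<open>orbit\<close>, adding \<open>q\<close> gives
  \<open>v + (r + q)\<close>, and suitable sums of these give \<open>v + q\<close>. The cases with
  \<open>v = 0\<close> are separate: \<open>q\<close> is given, and \<open>r\<close> is a root
  vector only if \<open>Q \<omega>\<close> is 0, where \<open>singular\<close> applies.\<close>

lemma plane_extension_D:
  assumes V: "\<And>v. v \<in> span G \<Longrightarrow> Q v \<Longrightarrow> v \<in> D"
    and pq: "B p q" "Q p" "Q q" "q \<in> D" "\<And>v. v \<in> span G \<Longrightarrow> \<not> B q v"
    and \<omega>: "\<omega> \<in> span G" "\<And>v. v \<in> span G \<Longrightarrow> B p v \<longleftrightarrow> B \<omega> v"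
    and orbit: "\<And>v. v \<in> span G \<Longrightarrow> v \<noteq> 0 \<Longrightarrow> Q v = Q \<omega> \<Longrightarrow> v + (p + \<omega>) \<in> D"
    and split: "\<And>v. v \<in> span G \<Longrightarrow> v \<noteq> 0 \<Longrightarrow> \<not> Q v \<Longrightarrow>
      \<exists>w\<in>span G. w \<noteq> 0 \<and> w \<noteq> v \<and> \<not> B v w \<and> Q w = Q \<omega>"
    and singular: "\<not> Q \<omega> \<Longrightarrow> \<exists>w\<in>span G. w \<noteq> 0 \<and> \<not> Q w"
    and u: "u \<in> span (insert p (insert q G))" "Q u"
  shows "u \<in> D"
proof -
  let ?V = "span G"
  define r where "r = p + \<omega>"
  note add = subspace_add[OF subspace_span[of G]]
  have r: "\<not> B r v" "\<not> B v r" "\<not> B v q" "\<not> B q v" if "v \<in> ?V" for v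
    using \<omega>(2)[OF that] pq(5)[OF that] B_sym[of v r] B_sym[of v q] by (auto simp: r_def B_add)
  have rq: "B r q" "B q r"
    using pq(1) r(3)[OF \<omega>(1)] B_sym[of r q] by (auto simp: r_def B_add)
  have Qr: "Q r \<longleftrightarrow> \<not> Q \<omega>"
    using pq(2) \<omega>(2)[OF \<omega>(1)] by (auto simp: r_def Q_add)
  have vr: "v + r \<in> D" if "v \<in> ?V" "v \<noteq> 0" "Q v = Q \<omega>" for v
    using orbit[OF that] by (simp add: r_def)
  have vrq: "v + (r + q) \<in> D" if "v \<in> ?V" "v \<noteq> 0" "Q v = Q \<omega>" for v
    using D_add[OF vr[OF that] pq(4)] r[OF that(1)] rq by (simp add: B_add add_ac)
  \<comment> \<open>\<open>v + q\<close> is the sum of \<open>w + r\<close> and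
    \<open>(w + v) + (r + q)\<close>, both already in \<open>D\<close>; they pair to 1 because
    \<open>w\<close> is orthogonal to \<open>v\<close>.\<close>
  have vq: "v + q \<in> D" if v: "v \<in> ?V" "\<not> Q v" for v
  proof (cases "v = 0")
    case True then show ?thesis using pq(4) by simp
  next
    case False
    obtain w where w: "w \<in> ?V" "w \<noteq> 0" "w \<noteq> v" "\<not> B v w" "Q w = Q \<omega>"
      using split[OF v(1) False v(2)] by blast
    have wv: "w + v \<in> ?V" "w + v \<noteq> 0" "Q (w + v) = Q \<omega>"
      using w that B_sym[of w v] add add_eq_0_iff_eq by (auto simp: Q_add)
    have "B (w + r) ((w + v) + (r + q))"
      using w(1,4) r[OF w(1)] r[OF wv(1)] rq r[OF that(1)] B_sym[of w v] by (auto simp: B_add B_add_right)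
    from D_add[OF vr[OF w(1,2,5)] vrq[OF wv] this] show ?thesis
      by (simp add: add_ac)
  qed
  \<comment> \<open>\<open>r\<close> is the sum of \<open>w + q\<close> and
    \<open>w + (r + q)\<close> for a nonzero singular \<open>w\<close>.\<close>
  have r_in: "r \<in> D" if \<omega>0: "\<not> Q \<omega>"
  proof -
    obtain w where w: "w \<in> ?V" "w \<noteq> 0" "\<not> Q w"
      using singular[OF \<omega>0] by blast
    have "B (w + q) (w + (r + q))"
      using r[OF w(1)] rq by (auto simp: B_add B_add_right)
    from D_add[OF vq[OF w(1,3)] vrq[OF w(1,2)] this] w(3) that show ?thesis
      by (simp add: add_ac)
  qed
  have main: "v + h \<in> D" if "v \<in> ?V" "h \<in> {0, q, r, r + q}" "Q (v + h)" for v h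
  proof -
    have "Q (v + q) \<longleftrightarrow> \<not> Q v" "Q (v + r) \<longleftrightarrow> (Q v = Q \<omega>)" "Q (v + (r + q)) \<longleftrightarrow> (Q v = Q \<omega>)"
      using that(1) r[OF that(1)] rq pq(3) Qr by (auto simp: Q_add B_add_right)
    moreover have "r + q \<in> D" if "\<not> Q \<omega>"
      using D_add[OF r_in[OF that] pq(4)] rq by simp
    ultimately show ?thesis
      using that V[of v] vq[of v] vr[of v] vrq[of v] r_in by (cases "v = 0") auto
  qed
  have p: "p = \<omega> + r"
    by (simp add: r_def add_ac)
  from u(1) show ?thesis
  proof (cases rule: span_insertE)
    case 1
    then show ?thesis
      using main[of u 0] main[of _ q] u(2) by (cases rule: span_insertE) auto
  next
    case (2 w)
    from 2(1) show ?thesis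
    proof (cases rule: span_insertE)
      case 1
      then show ?thesis
        using main[of "w + \<omega>" r] 2(2) add[OF 1 \<omega>(1)] u(2) by (simp add: p add_ac)
    next
      case (2 w')
      then have "u = (w' + \<omega>) + (r + q)"
        using \<open>u = w + p\<close> by (simp add: p add_ac)
      then show ?thesis
        using main[of "w' + \<omega>" "r + q"] add[OF 2(1) \<omega>(1)] u(2) by simp
    qed
  qed
qed

section \<open>Growth of the set of vectors with value 1\<close>

definition full :: "'v set \<Rightarrow> bool" where
  "full G \<longleftrightarrow> nondegenerate (span G) \<and> self_dual (span G) \<and> three_planes (span G) \<and>
     (\<forall>v\<in>span G. Q v \<longrightarrow> v \<in> D)"

text \<open>The root \<open>p\<close> equals \<open>\<omega> + r\<close> with \<open>r\<close>
  orthogonal to the old span. Roots of the old span move the summand \<omega> and fix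
  \<open>r\<close>; hence \<open>orbit_induct\<close> produces \<open>v + r\<close> for all nonzero
  \<open>v\<close> with \<open>Q v = Q \<omega>\<close>. The neighbor \<open>u\<close> of
  \<open>p\<close> ensures that \<omega> is nonzero.\<close>

lemma full_extension:
  assumes G: "full G"
    and pq: "B p q" "Q p" "Q q" "p \<in> D" "q \<in> D" "\<And>g. g \<in> G \<Longrightarrow> \<not> B q g"
    and u: "u \<in> G" "B p u"
  shows "full (insert p (insert q G))"
proof -
  note G' = G[unfolded full_def]
  have q: "\<not> B q v" if "v \<in> span G" for v
    using B_span_cong[OF that, of q 0] pq(6) by simp
  obtain \<omega> where \<omega>: "\<omega> \<in> span G" "\<And>v. v \<in> span G \<Longrightarrow> B p v \<longleftrightarrow> B \<omega> v"
    using G' additive_on_B[of "span G" p] unfolding self_dual_def by blast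
  have "\<omega> \<noteq> 0"
    using \<omega>(2)[OF span_base[OF u(1)]] u(2) by auto
  have orbit: "v + (p + \<omega>) \<in> D" if "v \<in> span G" "v \<noteq> 0" "Q v = Q \<omega>" for v
  proof (rule orbit_induct[where P = "\<lambda>v. v + (p + \<omega>) \<in> D" and v = \<omega>, OF subspace_span])
    show "\<omega> + (p + \<omega>) \<in> D"
      using pq(4) by (simp add: add_ac)
    show "u + d + (p + \<omega>) \<in> D"
      if "u \<in> span G" "d \<in> span G" "Q d" "B u d" "u + (p + \<omega>) \<in> D" for u d
      using D_add[OF that(5), of d] that G' \<omega>(2)[OF that(2)] by (auto simp: B_add add_ac)
  qed (use that \<omega>(1) \<open>\<omega> \<noteq> 0\<close> G' in auto)
  have "v \<in> D" if "v \<in> span (insert p (insert q G))" "Q v" for v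
  proof (rule plane_extension_D[OF _ pq(1-3,5) q \<omega> orbit _ _ that])
    show "\<exists>w\<in>span G. w \<noteq> 0 \<and> w \<noteq> v \<and> \<not> B v w \<and> Q w = Q \<omega>" for v
      using perp_both_values[OF subspace_span] G' by blast
    show "\<exists>w\<in>span G. w \<noteq> 0 \<and> \<not> Q w"
      using perp_both_values[OF subspace_span, of G 0 False] G' by auto
  qed (use G' in auto)
  moreover have "span G \<subseteq> span (insert p (insert q G))"
    by (rule span_mono) auto
  then have "three_planes (span (insert p (insert q G)))"
    using G' unfolding three_planes_def by (meson subsetD)
  ultimately show ?thesis
    using plane_extension[OF _ _ pq(1) q] G' unfolding full_def by blast
qed

text \<open>The base case is the Dynkin diagram of type \<open>E\<^sub>6\<close>, with the path \<open>a b c d\<close> and the path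
  \<open>c p q\<close>.\<close>

lemma full_E6:
  assumes D: "{a, b, c, d, p, q} \<subseteq> D" and Q: "Q a" "Q b" "Q c" "Q d" "Q p" "Q q"
    and B1: "B a b" "B b c" "B c d" "B c p" "B p q"
    and B0: "\<not> B a c" "\<not> B a d" "\<not> B a p" "\<not> B a q" "\<not> B b d" "\<not> B b p" "\<not> B b q" "\<not> B c q"
      "\<not> B d p" "\<not> B d q"
  shows "full {p, q, a, b, c, d}"
proof -
  have B1': "B b a" "B c b" "B d c" "B p c" "B q p"
    using B1 B_sym by blast+
  have B0': "\<not> B c a" "\<not> B d a" "\<not> B p a" "\<not> B q a" "\<not> B d b" "\<not> B p b" "\<not> B q b" "\<not> B q c"
    "\<not> B p d" "\<not> B q d"
    using B0[THEN B_symD] by blast+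
  note gram = Q B1 B0 B1' B0' Q_add B_add B_add_right
  have D6: "a \<in> D" "b \<in> D" "c \<in> D" "d \<in> D" "p \<in> D" "q \<in> D"
    using D by auto
  \<comment> \<open>Starting from the zero space, the pairs \<open>c, d\<close>, then
    \<open>b, a\<close>, then \<open>p, q\<close> are added; the second vector of each pair is
    orthogonal to what precedes.\<close>
  have nd: "nondegenerate (span {})" "self_dual (span {})"
    by (auto simp: nondegenerate_def self_dual_def additive_on_def)
  have nd2: "nondegenerate (span {c, d})" "self_dual (span {c, d})"
    using plane_extension[OF nd, of c d] by (auto simp: gram)
  have q2: "\<not> B a v" if "v \<in> span {c, d}" for v
  proof -
    have "B a v \<longleftrightarrow> B 0 v"
      by (rule B_span_cong[OF that]) (auto simp: gram)
    then show ?thesis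
      by simp
  qed
  have nd4: "nondegenerate (span {a, b, c, d})" "self_dual (span {a, b, c, d})"
    using plane_extension[OF nd2, of b a] q2 by (auto simp: gram insert_commute)
  \<comment> \<open>Among \<open>a, b, c, d\<close> both \<open>p\<close> and \<open>d\<close> are
    adjacent only to \<open>c\<close>. Thus \<open>d\<close> represents \<open>B p\<close> on this
    span.\<close>
  have q4: "\<not> B q v" "B p v \<longleftrightarrow> B d v" if "v \<in> span {a, b, c, d}" for v
  proof -
    have "B q v \<longleftrightarrow> B 0 v"
      by (rule B_span_cong[OF that]) (auto simp: gram)
    then show "\<not> B q v"
      by simp
    show "B p v \<longleftrightarrow> B d v"
      by (rule B_span_cong[OF that]) (auto simp: gram)
  qed
  have nd6: "nondegenerate (span {p, q, a, b, c, d})" "self_dual (span {p, q, a, b, c, d})"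
    using plane_extension[OF nd4, of p q] q4 by (auto simp: gram)
  have span4: "v \<in> {0, d, c, d + c, b, d + b, c + b, d + (c + b), a, d + a, c + a, d + (c + a), b + a,
      d + (b + a), c + (b + a), d + (c + (b + a))}" if "v \<in> span {a, b, c, d}" for v
    using that by (elim span_insertE) (auto simp: add_ac)
  have bc: "c + b \<in> D" "d + c \<in> D" "b + a \<in> D"
    using D_add D6 by (auto simp: gram)
  have bcd: "d + (c + b) \<in> D" "c + (b + a) \<in> D"
    using D_add[of d "c + b"] D_add[of c "b + a"] D6 bc by (auto simp: gram)
  have abcd: "d + (c + (b + a)) \<in> D"
    using D_add[of d "c + (b + a)"] D6 bcd by (auto simp: gram)
  \<comment> \<open>The vectors with value 1 here are the ten positive roots of type A4, all of them
    built above.\<close>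
  have D4: "v \<in> D" if "v \<in> span {a, b, c, d}" "Q v" for v
    using span4[OF that(1)] that(2) D6 bc bcd abcd by (auto simp: gram)
  \<comment> \<open>Only two planes are available so far, too few for \<open>orbit_induct\<close>.
    The sums of \<open>p + d\<close> with the ten roots of A4 are therefore reached one by one,
    starting from \<open>p\<close>.\<close>
  have p1: "c + p \<in> D"
    using D_add[of c p] D6 by (auto simp: gram)
  have p2: "c + b + p \<in> D" "c + p + d \<in> D"
    using D_add[of "c + p" d] D_add[of b "c + p"] D6 p1 by (auto simp: gram add_ac)
  have p3: "c + b + a + p \<in> D" "c + b + p + d \<in> D" "b + p + d \<in> D"
    using D_add[of a "c + b + p"] D_add[of b "c + p + d"] D_add[of "c + b" "c + p + d"] D6 p2 bc
    by (auto simp: gram add_ac)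
  have p4: "c + b + a + p + d \<in> D" "b + a + p + d \<in> D"
    using D_add[of a "c + b + p + d"] D_add[of a "b + p + d"] D6 p3 by (auto simp: gram add_ac)
  have p5: "a + p + d \<in> D"
    using D_add[of b "b + a + p + d"] D6 p4 by (auto simp: gram add_ac)
  have "v \<in> D" if "v \<in> span {p, q, a, b, c, d}" "Q v" for v
  proof (rule plane_extension_D[OF D4 _ _ _ _ q4(1) _ q4(2) _ _ _ that])
    show "d \<in> span {a, b, c, d}"
      by (rule span_base) simp
    show "v + (p + d) \<in> D" if "v \<in> span {a, b, c, d}" "v \<noteq> 0" "Q v = Q d" for v
      using span4[OF that(1)] that(2,3) D6 p1 p2 p3 p4 p5 by (auto simp: gram add_ac)
    show "\<exists>w\<in>span {a, b, c, d}. w \<noteq> 0 \<and> w \<noteq> v \<and> \<not> B v w \<and> Q w = Q d"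
      if "v \<in> span {a, b, c, d}" "v \<noteq> 0" "\<not> Q v" for v
    proof -
      \<comment> \<open>A functional vanishes somewhere on the nonzero vectors of the plane of
        \<open>a\<close> and \<open>b\<close>. These have value 1, so they differ from
        \<open>v\<close>.\<close>
      have "\<exists>w\<in>{a, b, b + a}. \<not> B v w"
        using span4[OF that(1)] by (auto simp: gram)
      then obtain w where "w \<in> {a, b, b + a}" "\<not> B v w"
        by blast
      moreover have "w \<in> span {a, b, c, d}"
        using \<open>w \<in> {a, b, b + a}\<close> span_base[of _ "{a, b, c, d}"] subspace_add[OF subspace_span]
        by auto
      moreover have "Q w"
        using \<open>w \<in> {a, b, b + a}\<close> by (auto simp: gram)
      ultimately show ?thesis
        using that(3) Q(4) by (intro bexI[of _ w]) auto
    qed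
  qed (use D6 in \<open>auto simp: gram\<close>)
  \<comment> \<open>The planes are \<open>d, c\<close> and \<open>a, b + d\<close> and
    \<open>q, p + d\<close>; adding \<open>d\<close> cancels the pairings of \<open>b\<close> and
    \<open>p\<close> with \<open>c\<close>.\<close>
  moreover have "three_planes (span {p, q, a, b, c, d})"
    unfolding three_planes_def
    by (rule bexI[of _ d], rule bexI[of _ c], rule bexI[of _ a], rule bexI[of _ "b + d"],
        rule bexI[of _ q], rule bexI[of _ "p + d"])
      (use span_base[of _ "{p, q, a, b, c, d}"] in
        \<open>auto simp: gram intro!: subspace_add[OF subspace_span]\<close>)
  ultimately show ?thesis
    using nd6 unfolding full_def by blast
qed

end

section \<open>The adjacency form and the game\<close>

text \<open>These rules turn the field operations into bitwise operations, where no algebra applies.\<close>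

declare add_bit_eq_xor [simp del] mult_bit_eq_and [simp del]

section \<open>The two forms of a graph\<close>

definition single :: "'a \<Rightarrow> 'a \<Rightarrow> bit" where
  "single s t = (if s = t then 1 else 0)"

definition bform :: "'a set \<Rightarrow> 'a set set \<Rightarrow> ('a \<Rightarrow> bit) \<Rightarrow> ('a \<Rightarrow> bit) \<Rightarrow> bit" where
  "bform W E u v = (\<Sum>s\<in>W. \<Sum>t\<in>W. if {s, t} \<in> E then u s * v t else 0)"

text \<open>The vertex sum is a sum of squares, because a bit equals its square. Each edge
  contributes its product once, whereas \<open>bform\<close> counts it in both orders.\<close>

definition qform :: "'a set \<Rightarrow> 'a set set \<Rightarrow> ('a \<Rightarrow> bit) \<Rightarrow> bit" where
  "qform W E v = (\<Sum>s\<in>W. v s) + (\<Sum>e\<in>E. \<Prod>s\<in>e. v s)"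

inductive_set roots :: "'a set \<Rightarrow> 'a set set \<Rightarrow> ('a \<Rightarrow> bit) set" for W E where
  single: "s \<in> W \<Longrightarrow> single s \<in> roots W E"
| add: "u \<in> roots W E \<Longrightarrow> v \<in> roots W E \<Longrightarrow> bform W E u v = 1 \<Longrightarrow> u + v \<in> roots W E"

definition lit_value :: "'a set \<Rightarrow> ('a \<Rightarrow> bit) \<Rightarrow> bit" where
  "lit_value C v = (\<Sum>s\<in>C. v s)"

lemma lit_value_single: "finite C \<Longrightarrow> lit_value C (single s) = (if s \<in> C then 1 else 0)"
  by (simp add: lit_value_def single_def sum.delta')

lemma bit_add_self [simp]: "b + b = 0" for b :: bit
  by (cases b) auto

lemma bit_add_eq_1_iff: "a + b = 1 \<longleftrightarrow> (a = 1) \<noteq> (b = 1)" for a b :: bit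
  by (cases a; cases b) auto

lemma bform_add_left: "bform W E (u + v) w = bform W E u w + bform W E v w"
  unfolding bform_def sum.distrib[symmetric]
  by (intro sum.cong refl) (simp add: algebra_simps)

lemma bform_sym: "bform W E u v = bform W E v u"
  unfolding bform_def by (subst sum.swap) (simp add: insert_commute mult.commute cong: if_cong)

lemma bform_single_right:
  assumes "finite W" "t \<in> W"
  shows "bform W E u (single t) = (\<Sum>s\<in>W. if {s, t} \<in> E then u s else 0)"
proof -
  have "(\<Sum>r\<in>W. if {s, r} \<in> E then u s * single t r else 0) = (if {s, t} \<in> E then u s else 0)" for s
  proof -
    have "(\<Sum>r\<in>W. if {s, r} \<in> E then u s * single t r else 0)
        = (\<Sum>r\<in>W. if t = r then (if {s, t} \<in> E then u s else 0) else 0)"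
      by (intro sum.cong refl) (auto simp: single_def)
    then show ?thesis
      using assms by (simp add: sum.delta')
  qed
  then show ?thesis
    by (simp add: bform_def)
qed

lemma bform_single:
  assumes "finite W" "s \<in> W" "t \<in> W"
  shows "bform W E (single s) (single t) = (if {s, t} \<in> E then 1 else 0)"
proof -
  have "bform W E (single s) (single t) = (\<Sum>r\<in>W. if s = r then (if {s, t} \<in> E then 1 else 0) else 0)"
    unfolding bform_single_right[OF assms(1,3)] by (intro sum.cong refl) (auto simp: single_def)
  then show ?thesis
    using assms by (simp add: sum.delta')
qed

lemma bform_expand:
  assumes "finite W"
  shows "bform W E u v = (\<Sum>t\<in>W. bform W E u (single t) * v t)"
proof -
  have "bform W E u v = (\<Sum>t\<in>W. \<Sum>s\<in>W. if {s, t} \<in> E then u s * v t else 0)"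
    unfolding bform_def by (rule sum.swap)
  also have "\<dots> = (\<Sum>t\<in>W. bform W E u (single t) * v t)"
    by (intro sum.cong refl) (simp add: bform_single_right[OF assms] sum_distrib_right if_distrib[of "\<lambda>x. x * _"] cong: if_cong)
  finally show ?thesis .
qed

context
  fixes W :: "'a set" and E :: "'a set set"
  assumes graph: "finite_simple_graph W E"
begin

lemma finite_W: "finite W" and edge_subset: "e \<in> E \<Longrightarrow> e \<subseteq> W" and edge_card: "e \<in> E \<Longrightarrow> card e = 2"
  using graph by (auto simp: finite_simple_graph_def)

lemma finite_E: "finite E"
  using finite_subset[of E "Pow W"] finite_W edge_subset by auto

lemma qform_single:
  assumes "s \<in> W"
  shows "qform W E (single s) = 1"
proof -
  have "(\<Prod>t\<in>e. single s t) = 0" if "e \<in> E" for e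
  proof -
    have "\<not> e \<subseteq> {s}"
      using edge_card[OF that] card_mono[of "{s}" e] by auto
    then obtain t where "t \<in> e" "t \<noteq> s"
      by blast
    then have "t \<in> e" "single s t = 0"
      by (auto simp: single_def)
    moreover have "finite e"
      using edge_card[OF that] card.infinite by fastforce
    ultimately show ?thesis
      by (metis prod_zero)
  qed
  then show ?thesis
    using assms finite_W by (simp add: qform_def single_def sum.delta')
qed

text \<open>Expanding the product over an edge gives two mixed terms. They are exactly the terms of
  \<open>bform\<close> for the two orderings of that edge, so the double sum is grouped by
  edges.\<close>

lemma qform_add: "qform W E (u + v) = qform W E u + qform W E v + bform W E u v"
proof -
  let ?P = "{(s, t) \<in> W \<times> W. {s, t} \<in> E}"
  let ?h = "\<lambda>(s, t). u s * v t"
  have fin: "finite ?P"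
    by (rule finite_subset[of _ "W \<times> W"]) (use finite_W in auto)
  have "bform W E u v = (\<Sum>x\<in>W \<times> W. if x \<in> ?P then ?h x else 0)"
    unfolding bform_def sum.cartesian_product by (intro sum.cong) (auto split: if_splits)
  also have "\<dots> = (\<Sum>x\<in>?P. ?h x)"
  proof -
    have "?P = (W \<times> W) \<inter> ?P"
      by auto
    then show ?thesis
      using sum.inter_restrict[of "W \<times> W" ?h ?P] finite_W by simp
  qed
  also have "\<dots> = (\<Sum>e\<in>E. \<Sum>x\<in>{x \<in> ?P. (\<lambda>(s, t). {s, t}) x = e}. ?h x)"
    by (rule sum.group[symmetric]) (use fin finite_E in auto)
  finally have b: "bform W E u v = (\<Sum>e\<in>E. \<Sum>x\<in>{x \<in> ?P. (\<lambda>(s, t). {s, t}) x = e}. ?h x)" .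
  have "(\<Prod>s\<in>e. (u + v) s) = (\<Prod>s\<in>e. u s) + (\<Prod>s\<in>e. v s)
      + (\<Sum>x\<in>{x \<in> ?P. (\<lambda>(s, t). {s, t}) x = e}. ?h x)" if e: "e \<in> E" for e
  proof -
    obtain s t where st: "e = {s, t}" "s \<noteq> t"
      using edge_card[OF e] by (auto simp: card_2_iff)
    have "{x \<in> ?P. (\<lambda>(s, t). {s, t}) x = e} = {(s, t), (t, s)}"
      using st e edge_subset[OF e] by (auto simp: doubleton_eq_iff insert_commute)
    then show ?thesis
      using st by (simp add: algebra_simps)
  qed
  then have "(\<Sum>e\<in>E. \<Prod>s\<in>e. (u + v) s) = (\<Sum>e\<in>E. \<Prod>s\<in>e. u s) + (\<Sum>e\<in>E. \<Prod>s\<in>e. v s) + bform W E u v"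
    by (simp only: b sum.distrib cong: sum.cong)
  then show ?thesis
    by (simp add: qform_def sum.distrib add_ac)
qed

lemma f2_quadratic_graph:
  "f2_quadratic (\<lambda>u v. bform W E u v = 1) (\<lambda>v. qform W E v = 1) (roots W E)"
proof
  show "v + v = 0" for v :: "'a \<Rightarrow> bit"
    by (rule ext) simp
  show "bform W E u v = 1 \<longleftrightarrow> bform W E v u = 1" for u v
    by (simp only: bform_sym[of W E u v])
qed (auto simp: bform_add_left bit_add_eq_1_iff qform_add intro: roots.add)

definition flip :: "('a \<Rightarrow> bit) \<Rightarrow> 'a set \<Rightarrow> 'a set" where
  "flip d C = sym_diff C {t \<in> W. bform W E d (single t) = 1}"

text \<open>Symmetric difference of configurations is addition of functionals, and the set of
  flipped vertices is the configuration whose functional is \<open>B d\<close>.\<close>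

lemma lit_value_flip:
  assumes "finite C"
  shows "lit_value (flip d C) v = lit_value C v + bform W E d v"
proof -
  let ?N = "{t \<in> W. bform W E d (single t) = 1}"
  have "(\<Sum>s\<in>sym_diff C ?N. v s) = (\<Sum>s\<in>C. v s) + (\<Sum>s\<in>?N. v s)"
  proof -
    have fin: "finite ?N"
      using finite_W by simp
    have "(\<Sum>s\<in>C. v s) = (\<Sum>s\<in>C - ?N. v s) + (\<Sum>s\<in>C \<inter> ?N. v s)"
      by (subst add.commute) (rule sum.Int_Diff[OF assms])
    moreover have "(\<Sum>s\<in>?N. v s) = (\<Sum>s\<in>?N - C. v s) + (\<Sum>s\<in>C \<inter> ?N. v s)"
      by (subst add.commute, subst Int_commute) (rule sum.Int_Diff[OF fin])
    moreover have "(\<Sum>s\<in>sym_diff C ?N. v s) = (\<Sum>s\<in>C - ?N. v s) + (\<Sum>s\<in>?N - C. v s)"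
      by (rule sum.union_disjoint) (auto simp: assms fin)
    ultimately show ?thesis
      by (simp add: add_ac flip: add.assoc)
  qed
  moreover have "(\<Sum>s\<in>?N. v s) = bform W E d v"
    unfolding bform_expand[OF finite_W, of E d v]
    by (rule sum.mono_neutral_cong_left) (auto simp: finite_W)
  ultimately show ?thesis
    by (simp add: lit_value_def flip_def)
qed

lemma flip_subset: "C \<subseteq> W \<Longrightarrow> flip d C \<subseteq> W"
  by (auto simp: flip_def)

lemma config_eqI:
  assumes "C \<subseteq> W" "C' \<subseteq> W" "\<And>s. s \<in> W \<Longrightarrow> lit_value C (single s) = lit_value C' (single s)"
  shows "C = C'"
proof -
  have "finite C" "finite C'"
    using assms finite_W finite_subset by blast+
  then show ?thesis
    using assms by (fastforce simp: lit_value_single split: if_splits)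
qed

text \<open>For \<open>d = u + v\<close> exactly one of \<open>u\<close> and \<open>v\<close> has value 1, and the move along it makes the other one
  available because \<open>B u v = 1\<close>.\<close>

lemma lit_move_root:
  assumes "d \<in> roots W E" "C \<subseteq> W" "lit_value C d = 1"
  shows "(lit_move W E)\<^sup>*\<^sup>* C (flip d C)"
  using assms
proof (induction arbitrary: C)
  case (single s)
  then have "s \<in> C"
    using finite_subset[OF single(2) finite_W] lit_value_single[of C s] by (auto split: if_splits)
  moreover have "{t \<in> W. bform W E (single s) (single t) = 1} = neighbors W E s"
    using single(1) finite_W by (auto simp: bform_single neighbors_def split: if_splits)
  ultimately show ?case
    by (auto simp: lit_move_def flip_def)
next
  case (add u v)
  have *: "(lit_move W E)\<^sup>*\<^sup>* C (flip (u + v) C)"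
    if "bform W E u v = 1" "lit_value C u = 1" "lit_value C v = 0"
      and IH: "\<And>C. C \<subseteq> W \<Longrightarrow> lit_value C u = 1 \<Longrightarrow> (lit_move W E)\<^sup>*\<^sup>* C (flip u C)"
        "\<And>C. C \<subseteq> W \<Longrightarrow> lit_value C v = 1 \<Longrightarrow> (lit_move W E)\<^sup>*\<^sup>* C (flip v C)" for u v
  proof -
    have fin: "finite C" "finite (flip u C)"
      using finite_subset[OF add.prems(1) finite_W] finite_subset[OF flip_subset[OF add.prems(1)] finite_W]
      by auto
    have "lit_value (flip u C) v = 1"
      using that(1-3) by (simp add: lit_value_flip[OF fin(1)])
    then have "(lit_move W E)\<^sup>*\<^sup>* (flip u C) (flip v (flip u C))"
      by (intro IH flip_subset add.prems)
    moreover have "flip v (flip u C) = flip (u + v) C"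
      by (rule config_eqI)
        (simp_all add: flip_subset add.prems lit_value_flip fin bform_add_left add_ac)
    ultimately show ?thesis
      using IH(1)[OF add.prems(1)] that(2) by auto
  qed
  have "lit_value C (u + v) = lit_value C u + lit_value C v"
    by (simp add: lit_value_def sum.distrib)
  then consider "lit_value C u = 1" "lit_value C v = 0" | "lit_value C v = 1" "lit_value C u = 0"
    using add.prems(2) by (cases "lit_value C u"; cases "lit_value C v") auto
  then show ?case
  proof cases
    case 1
    then show ?thesis
      using *[OF add.hyps(3)] add.IH by blast
  next
    case 2
    have "bform W E v u = 1"
      using add.hyps(3) by (simp only: bform_sym[of W E v u])
    then have "(lit_move W E)\<^sup>*\<^sup>* C (flip (v + u) C)"
      using *[OF _ 2] add.IH by blast
    then show ?thesis
      by (simp only: add.commute[of v u])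
  qed
qed

end

section \<open>Paths and alternating paths in trees\<close>

lemma path_edges_subset_iff:
  "set (path_edges p) \<subseteq> R \<longleftrightarrow> successively (\<lambda>a b. {a, b} \<in> R) p"
  by (induction p rule: path_edges.induct) auto

lemma joining_path_iff:
  "joining_path S R u p v \<longleftrightarrow> p \<noteq> [] \<and> hd p = u \<and> last p = v \<and> distinct p \<and> set p \<subseteq> S \<and>
     successively (\<lambda>a b. {a, b} \<in> R) p"
  by (simp add: joining_path_def path_edges_subset_iff)

lemma path_edges_snoc: "p \<noteq> [] \<Longrightarrow> path_edges (p @ [c]) = path_edges p @ [{last p, c}]"
  by (induction p rule: path_edges.induct) auto

lemma path_edges_append_Cons:
  "path_edges (p @ a # q) = path_edges (p @ [a]) @ path_edges (a # q)"
  by (induction p rule: path_edges.induct) auto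

lemma length_path_edges [simp]: "length (path_edges p) = length p - 1"
  by (induction p rule: path_edges.induct) auto

lemma path_edges_nth: "Suc i < length p \<Longrightarrow> path_edges p ! i = {p ! i, p ! Suc i}"
  by (induction p arbitrary: i rule: path_edges.induct) (auto simp: nth_Cons split: nat.splits)

lemma path_edges_in_set: "e \<in> set (path_edges p) \<Longrightarrow> e \<subseteq> set p"
  by (induction p rule: path_edges.induct) auto

lemma alternating_iff: "alternating P p \<longleftrightarrow> successively (\<lambda>e f. e \<in> P \<longleftrightarrow> f \<notin> P) (path_edges p)"
  by (simp add: alternating_def successively_conv_nth)

lemma joining_path_rev: "joining_path S R u p v \<Longrightarrow> joining_path S R v (rev p) u"
  by (auto simp: joining_path_iff hd_rev last_rev insert_commute)

lemma joining_path_mono: "joining_path S R u p v \<Longrightarrow> S \<subseteq> S' \<Longrightarrow> joining_path S' R u p v"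
  by (auto simp: joining_path_def)

lemma joining_path_snoc:
  "joining_path S R u p v \<Longrightarrow> {v, c} \<in> R \<Longrightarrow> c \<in> S \<Longrightarrow> c \<notin> set p \<Longrightarrow> joining_path S R u (p @ [c]) c"
  by (auto simp: joining_path_iff successively_append_iff)

lemma leaving_edge:
  assumes "successively (\<lambda>a b. {a, b} \<in> R) p" "p \<noteq> []" "hd p \<in> X" "last p \<notin> X"
  shows "\<exists>a b. a \<in> X \<and> b \<notin> X \<and> {a, b} \<in> R \<and> b \<in> set p"
  using assms
proof (induction p rule: induct_list012)
  case (3 a b p)
  then show ?case by (cases "b \<in> X") auto
qed auto

context
  fixes S :: "'a set" and R :: "'a set set"
  assumes tree: "finite_tree S R"
begin

section \<open>Unique paths and subtrees\<close>

lemma tree_graph: "finite_simple_graph S R"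
  and finite_vertices: "finite S"
  and tree_connected: "u \<in> S \<Longrightarrow> v \<in> S \<Longrightarrow> \<exists>p. joining_path S R u p v"
  and tree_acyclic: "\<not> graph_cycle S R c"
  using tree by (auto simp: finite_tree_def finite_simple_graph_def)

lemma edge_in: "{u, v} \<in> R \<Longrightarrow> u \<in> S \<and> v \<in> S \<and> u \<noteq> v"
  using tree_graph by (fastforce simp: finite_simple_graph_def)

text \<open>Let \<open>w\<close> be the first vertex after the start of one path that lies on the
  other. Either \<open>w\<close> comes next on both paths and induction applies, or the two initial
  segments up to \<open>w\<close> form a cycle.\<close>

lemma unique_path:
  assumes "joining_path S R u p v" "joining_path S R u q v"
  shows "p = q"
  using assms
proof (induction p arbitrary: u q)
  case Nil
  then show ?case by (simp add: joining_path_iff)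
next
  case (Cons u' p' u q)
  then have [simp]: "u' = u" by (simp add: joining_path_iff)
  obtain q' where q: "q = u # q'"
    using Cons.prems(2) by (cases q) (auto simp: joining_path_iff)
  show ?case
  proof (cases "p' = [] \<or> q' = []")
    case True
    then show ?thesis
      using Cons.prems q by (auto simp: joining_path_iff split: if_splits)
  next
    case False
    have "v \<in> set p'" "v \<in> set q'"
      using Cons.prems False q last_in_set[of p'] last_in_set[of q']
      by (auto simp: joining_path_iff simp del: last_in_set)
    then obtain p1 w p2 where p': "p' = p1 @ w # p2" "w \<in> set q'" "\<forall>y\<in>set p1. y \<notin> set q'"
      using split_list_first_prop[of p' "\<lambda>y. y \<in> set q'"] by blast
    obtain q1 q2 where q': "q' = q1 @ w # q2"
      using split_list[OF p'(2)] by blast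
    show ?thesis
    proof (cases "p1 = [] \<and> q1 = []")
      case True
      then have "joining_path S R w p' v" "joining_path S R w q' v"
        using Cons.prems q p' q' by (auto simp: joining_path_iff)
      then show ?thesis
        using Cons.IH q by simp
    next
      case False
      have "length (u # p1 @ w # rev q1) \<ge> 3"
        using False by (cases p1; cases q1) auto
      moreover have "distinct (u # p1 @ w # rev q1)"
        using Cons.prems q p' q' by (auto simp: joining_path_iff)
      moreover have "set (u # p1 @ w # rev q1) \<subseteq> S"
        using Cons.prems q p' q' by (auto simp: joining_path_iff)
      moreover have "successively (\<lambda>a b. {a, b} \<in> R) ((u # p1 @ w # rev q1) @ [u])"
      proof -
        have 1: "successively (\<lambda>a b. {a, b} \<in> R) ((u # p1) @ [w])"
          using Cons.prems(1) p' successively_append_iff[of _ "(u # p1) @ [w]" p2]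
          by (auto simp: joining_path_iff)
        have "successively (\<lambda>a b. {a, b} \<in> R) (u # q1 @ [w])"
          using Cons.prems(2) q q' successively_append_iff[of _ "u # q1 @ [w]" q2]
          by (auto simp: joining_path_iff)
        then have "successively (\<lambda>a b. {a, b} \<in> R) (rev (u # q1 @ [w]))"
          unfolding successively_rev by (simp add: insert_commute)
        then have 2: "successively (\<lambda>a b. {a, b} \<in> R) (w # rev q1 @ [u])"
          by simp
        have "successively (\<lambda>a b. {a, b} \<in> R) (u # p1)" "{last (u # p1), w} \<in> R"
          using 1 unfolding successively_append_iff by auto
        then have "successively (\<lambda>a b. {a, b} \<in> R) ((u # p1) @ (w # rev q1 @ [u]))"
          using 2 unfolding successively_append_iff by auto
        then show ?thesis
          by simp
      qed
      ultimately have "graph_cycle S R (u # p1 @ w # rev q1)"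
        unfolding graph_cycle_def path_edges_subset_iff by simp
      then show ?thesis
        using tree_acyclic by blast
    qed
  qed
qed

lemma path_single: "s \<in> S \<Longrightarrow> joining_path S R s [s] s"
  by (simp add: joining_path_iff)

lemma path_edge: "{s, t} \<in> R \<Longrightarrow> joining_path S R s [s, t] t"
  using edge_in[of s t] by (simp add: joining_path_iff)

lemma path_edge2: "{s, m} \<in> R \<Longrightarrow> {m, t} \<in> R \<Longrightarrow> s \<noteq> t \<Longrightarrow> joining_path S R s [s, m, t] t"
  using edge_in[of s m] edge_in[of m t] by (simp add: joining_path_iff)

text \<open>The part of the path up to \<open>c\<close> followed by the edge to \<open>t\<close> is
  also a path to \<open>t\<close>, so uniqueness makes \<open>c\<close> the vertex before
  \<open>t\<close>.\<close>

lemma neighbor_on_path: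
  assumes p: "joining_path S R s p t" and tc: "{t, c} \<in> R" "c \<in> set p"
  obtains p' where "p = p' @ [t]" "joining_path S R s p' c"
proof -
  obtain p1 p2 where p12: "p = p1 @ c # p2"
    using split_list[OF tc(2)] by blast
  have "p2 \<noteq> []"
    using p p12 edge_in[OF tc(1)] by (auto simp: joining_path_iff)
  then have "t \<in> set p2"
    using p p12 by (auto simp: joining_path_iff split: if_splits)
  have 1: "joining_path S R s (p1 @ [c]) c"
    using p p12 by (auto simp: joining_path_iff successively_append_iff hd_append)
  have "t \<notin> set (p1 @ [c])"
    using p p12 \<open>t \<in> set p2\<close> by (auto simp: joining_path_iff)
  then have "joining_path S R s ((p1 @ [c]) @ [t]) t"
    using joining_path_snoc[OF 1, of t] tc edge_in[OF tc(1)] by (simp add: insert_commute)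
  then have "p = (p1 @ [c]) @ [t]"
    by (rule unique_path[OF p])
  then show thesis
    using that 1 by blast
qed

definition connected_in :: "'a set \<Rightarrow> bool" where
  "connected_in T \<longleftrightarrow> (\<forall>u\<in>T. \<forall>v\<in>T. \<exists>p. joining_path T R u p v)"

lemma connected_in_insert:
  assumes "connected_in T" "u \<in> T" "{u, p} \<in> R" "p \<notin> T"
  shows "connected_in (insert p T)"
proof -
  have mono: "joining_path T R v l w \<Longrightarrow> joining_path (insert p T) R v l w" for v l w
    using joining_path_mono[of T R v l w "insert p T"] by blast
  have to_p: "\<exists>l. joining_path (insert p T) R v l p" if v: "v \<in> T" for v
  proof -
    obtain l where l: "joining_path T R v l u"
      using assms(1,2) v unfolding connected_in_def by blast
    then have "p \<notin> set l"
      using assms(4) by (auto simp: joining_path_def)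
    then show ?thesis
      using joining_path_snoc[OF mono[OF l] assms(3)] by blast
  qed
  show ?thesis
    unfolding connected_in_def
  proof (intro ballI)
    fix v w assume "v \<in> insert p T" "w \<in> insert p T"
    then consider "v = p" "w = p" | "v = p" "w \<in> T" | "v \<in> T" "w = p" | "v \<in> T" "w \<in> T"
      by blast
    then show "\<exists>l. joining_path (insert p T) R v l w"
    proof cases
      case 1
      then have "joining_path (insert p T) R v [p] w"
        by (simp add: joining_path_iff)
      then show ?thesis ..
    next
      case 2
      obtain l where "joining_path (insert p T) R w l p"
        using to_p[OF 2(2)] ..
      from joining_path_rev[OF this] 2(1) show ?thesis
        by blast
    next
      case 3
      then show ?thesis using to_p by blast
    next
      case 4
      then obtain l where "joining_path T R v l w"
        using assms(1) unfolding connected_in_def by blast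
      from mono[OF this] show ?thesis ..
    qed
  qed
qed

text \<open>A second neighbor would give a second path from \<open>u\<close> to \<open>p\<close>,
  passing through \<open>T\<close> instead of along the edge.\<close>

lemma unique_neighbor:
  assumes "connected_in T" "T \<subseteq> S" "p \<notin> T" "u \<in> T" "u' \<in> T" "{u, p} \<in> R" "{u', p} \<in> R"
  shows "u = u'"
proof -
  obtain l where l: "joining_path T R u l u'"
    using assms unfolding connected_in_def by blast
  then have "joining_path S R u (l @ [p]) p"
    using joining_path_snoc[of S R u l u' p] joining_path_mono[OF l assms(2)] assms edge_in[of u' p]
    by (auto simp: joining_path_def)
  from unique_path[OF this path_edge[OF assms(6)]] l show ?thesis
    by (cases l) (auto simp: joining_path_iff)
qed

text \<open>A longest path is taken. If it misses a vertex, some edge leaves it, by maximality not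
  at an end, and an inner vertex with such an edge has three neighbors.\<close>

lemma path_or_branching:
  obtains l where "distinct l" "S = set l" "R = set (path_edges l)"
  | c d\<^sub>1 d\<^sub>2 d\<^sub>3 where "{c, d\<^sub>1} \<in> R" "{c, d\<^sub>2} \<in> R" "{c, d\<^sub>3} \<in> R" "d\<^sub>1 \<noteq> d\<^sub>2" "d\<^sub>1 \<noteq> d\<^sub>3" "d\<^sub>2 \<noteq> d\<^sub>3"
proof (cases "\<exists>c d\<^sub>1 d\<^sub>2 d\<^sub>3. {c, d\<^sub>1} \<in> R \<and> {c, d\<^sub>2} \<in> R \<and> {c, d\<^sub>3} \<in> R \<and> d\<^sub>1 \<noteq> d\<^sub>2 \<and> d\<^sub>1 \<noteq> d\<^sub>3 \<and> d\<^sub>2 \<noteq> d\<^sub>3")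
  case True
  then show thesis
    by (elim exE conjE) (rule that(2))
next
  case False
  define path where "path l \<longleftrightarrow> l \<noteq> [] \<and> distinct l \<and> set l \<subseteq> S \<and> successively (\<lambda>a b. {a, b} \<in> R) l" for l
  have bound: "length l \<le> card S" if "path l" for l
    using that finite_vertices card_mono[of S "set l"] distinct_card[of l] by (auto simp: path_def)
  obtain r where "r \<in> S"
    using tree unfolding finite_tree_def by blast
  then have "path [r]"
    by (simp add: path_def)
  moreover have "\<forall>l. path l \<longrightarrow> length l < Suc (card S)"
    using bound less_Suc_eq_le by blast
  ultimately obtain l where l: "path l" and max: "\<And>l'. path l' \<Longrightarrow> length l' \<le> length l"
    using ex_has_greatest_nat[of path "[r]" length "Suc (card S)"] by blast
  have cover: "set l = S"
  proof (rule ccontr)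
    assume "set l \<noteq> S"
    then obtain v where v: "v \<in> S" "v \<notin> set l"
      using l by (auto simp: path_def)
    have "hd l \<in> S" "hd l \<in> set l"
      using l by (auto simp: path_def)
    then obtain p where "joining_path S R (hd l) p v"
      using tree_connected[OF _ v(1)] by blast
    then have p: "successively (\<lambda>a b. {a, b} \<in> R) p" "p \<noteq> []" "hd p \<in> set l" "last p \<notin> set l" "set p \<subseteq> S"
      using v(2) \<open>hd l \<in> set l\<close> by (simp_all add: joining_path_iff)
    obtain a c where ac: "a \<in> set l" "c \<notin> set l" "{a, c} \<in> R" "c \<in> S"
      using leaving_edge[OF p(1-4)] p(5) by blast
    obtain l1 l2 where l12: "l = l1 @ a # l2"
      using split_list[OF ac(1)] by blast
    have "l1 \<noteq> []"
    proof
      assume "l1 = []"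
      then have "path (c # l)"
        using l ac l12 by (auto simp: path_def insert_commute)
      from max[OF this] show False
        by simp
    qed
    moreover have "l2 \<noteq> []"
    proof
      assume "l2 = []"
      then have "path (l @ [c])"
        using l ac l12 by (auto simp: path_def successively_append_iff)
      from max[OF this] show False
        by simp
    qed
    ultimately have "{last l1, a} \<in> R" "{a, hd l2} \<in> R" "last l1 \<in> set l1" "hd l2 \<in> set l2"
      using l l12 by (auto simp: path_def successively_append_iff successively_Cons)
    moreover have "last l1 \<noteq> hd l2" "last l1 \<noteq> c" "hd l2 \<noteq> c"
      using calculation(3,4) l l12 ac(2) by (auto simp: path_def)
    ultimately show False
      using False ac(3) insert_commute[of "last l1" a "{}"] by auto
  qed
  have "e \<in> set (path_edges l)" if e: "e \<in> R" for e
  proof -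
    obtain u v where uv: "e = {u, v}" "u \<noteq> v"
      using tree_graph e by (auto simp: finite_simple_graph_def card_2_iff)
    \<comment> \<open>The segment of \<open>l\<close> from \<open>u\<close> to \<open>v\<close> and
      the edge itself are both paths; by uniqueness the two vertices are consecutive in
      \<open>l\<close>.\<close>
    have *: "{u, v} \<in> set (path_edges l)" if l12: "l = l1 @ u # l2" "v \<in> set l2" "{u, v} \<in> R" for u v l1 l2
    proof -
      obtain l3 l4 where l34: "l2 = l3 @ v # l4"
        using split_list[OF l12(2)] by blast
      have "joining_path S R u (u # l3 @ [v]) v"
      proof -
        have "path (l1 @ (u # l3 @ [v]) @ l4)"
          using l l12(1) l34 by simp
        then have "successively (\<lambda>a b. {a, b} \<in> R) (u # l3 @ [v])" "distinct (u # l3 @ [v])"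
          "set (u # l3 @ [v]) \<subseteq> S"
          unfolding path_def successively_append_iff[of _ l1] successively_append_iff[of _ "u # l3 @ [v]"]
          by auto
        then show ?thesis
          by (simp add: joining_path_iff)
      qed
      from unique_path[OF this path_edge[OF l12(3)]] show ?thesis
        using l12(1) l34 path_edges_append_Cons[of l1 u "v # l4"] by simp
    qed
    have "u \<in> set l" "v \<in> set l"
      using cover edge_in[of u v] e uv by auto
    then obtain l1 l2 where "l = l1 @ u # l2"
      using split_list[of u l] by blast
    then consider "v \<in> set l2" | "v \<in> set l1"
      using \<open>v \<in> set l\<close> uv by auto
    then show ?thesis
    proof cases
      case 1
      then show ?thesis using * \<open>l = l1 @ u # l2\<close> e uv by blast
    next
      case 2
      then obtain l3 l4 where "l1 = l3 @ v # l4"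
        using split_list[of v l1] by blast
      then show ?thesis
        using *[of l3 v "l4 @ u # l2" u] \<open>l = l1 @ u # l2\<close> e uv by (simp add: insert_commute)
    qed
  qed
  then have "R = set (path_edges l)"
    using l path_edges_subset_iff[of l R] by (auto simp: path_def)
  moreover have "distinct l"
    using l by (simp add: path_def)
  ultimately show thesis
    using that(1)[OF _ cover[symmetric]] by blast
qed

end

context
  fixes S :: "'a set" and R P :: "'a set set"
  assumes tree: "finite_tree S R" and matching: "perfect_matching S R P"
begin

section \<open>Matchings and alternating paths\<close>

lemma matching_edge: "{u, v} \<in> P \<Longrightarrow> {u, v} \<in> R"
  using matching by (auto simp: perfect_matching_def)

lemma matching_unique:
  assumes "{u, v} \<in> P" "{u, w} \<in> P"
  shows "v = w"
proof -
  have "u \<in> S" "u \<noteq> v" "u \<noteq> w"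
    using edge_in[OF tree matching_edge] assms by blast+
  moreover have "{u, v} = {u, w}"
    using matching assms \<open>u \<in> S\<close> unfolding perfect_matching_def by blast
  ultimately show ?thesis
    by (auto simp: doubleton_eq_iff)
qed

lemma partner_exists:
  assumes "u \<in> S"
  obtains v where "{u, v} \<in> P"
proof -
  obtain e where "e \<in> P" "u \<in> e"
    using matching assms unfolding perfect_matching_def by blast
  moreover have "card e = 2"
    using calculation matching tree_graph[OF tree]
    by (auto simp: perfect_matching_def finite_simple_graph_def)
  ultimately show thesis
    using that by (auto simp: card_2_iff insert_commute)
qed

lemma alt_set_iff:
  assumes "joining_path S R s p t"
  shows "t \<in> alt_set S R P s \<longleftrightarrow> t \<noteq> s \<and> alternating P p \<and>
    hd (path_edges p) \<in> P \<and> last (path_edges p) \<in> P"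
proof -
  have "t \<in> S"
    using assms by (auto simp: joining_path_iff)
  then show ?thesis
    using assms unique_path[OF tree assms] unfolding alt_set_def by blast
qed

lemma alt_set_subset: "alt_set S R P s \<subseteq> S - {s}"
  by (auto simp: alt_set_def)

lemma alt_set_adjacent: "{s, t} \<in> R \<Longrightarrow> t \<in> alt_set S R P s \<longleftrightarrow> {s, t} \<in> P"
  using alt_set_iff[OF path_edge[OF tree]] edge_in[OF tree, of s t] by (auto simp: alternating_iff)

lemma alt_set_distance_2:
  "{s, m} \<in> R \<Longrightarrow> {m, t} \<in> R \<Longrightarrow> s \<noteq> t \<Longrightarrow> t \<notin> alt_set S R P s"
  using alt_set_iff[OF path_edge2[OF tree]] by (auto simp: alternating_iff)

text \<open>Splits off the last edge and records that every neighbor of \<open>t\<close> other than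
  its predecessor \<open>t0\<close> prolongs the path.\<close>

lemma path_lastE:
  assumes p: "joining_path S R s p t" and "s \<noteq> t"
  obtains p' t0 where "p = p' @ [t]" "joining_path S R s p' t0" "{t, t0} \<in> R" "t0 \<noteq> t"
    "path_edges p = path_edges p' @ [{t, t0}]"
    "\<And>c. {t, c} \<in> R \<Longrightarrow> c \<noteq> t0 \<Longrightarrow> joining_path S R s (p @ [c]) c"
proof -
  define p' where "p' = butlast p"
  have p': "p = p' @ [t]"
    unfolding p'_def using p append_butlast_last_id unfolding joining_path_iff by metis
  have "p' \<noteq> []"
  proof
    assume "p' = []"
    then have "p = [t]"
      using p' by simp
    then show False
      using p \<open>s \<noteq> t\<close> by (simp add: joining_path_iff)
  qed
  note p' = p' this
  define t0 where "t0 = last p'"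
  have 1: "joining_path S R s p' t0" "{t, t0} \<in> R" "t0 \<in> set p'"
    using p p' by (auto simp: joining_path_iff successively_append_iff t0_def insert_commute)
  have 2: "joining_path S R s (p @ [c]) c" if "{t, c} \<in> R" "c \<noteq> t0" for c
  proof -
    have "c \<notin> set p"
      using neighbor_on_path[OF tree p that(1)] that(2) p' 1(1)
      by (metis append1_eq_conv joining_path_iff)
    then show ?thesis
      using joining_path_snoc[OF p that(1)] edge_in[OF tree that(1)] by blast
  qed
  show thesis
    using that[OF p'(1) 1(1,2) _ _ 2] edge_in[OF tree 1(2)] p' 
    by (auto simp: path_edges_snoc t0_def insert_commute)
qed

lemma alt_set_beyond:
  assumes p: "joining_path S R s p t" and "s \<noteq> t" and pc: "joining_path S R s (p @ [c]) c"
  shows "c \<in> alt_set S R P s \<longleftrightarrow> {t, c} \<in> P \<and> alternating P p \<and> hd (path_edges p) \<in> P \<and>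
    last (path_edges p) \<notin> P"
proof -
  have "path_edges p \<noteq> []"
    using p \<open>s \<noteq> t\<close> by (cases p rule: path_edges.cases) (auto simp: joining_path_iff)
  moreover have "path_edges (p @ [c]) = path_edges p @ [{t, c}]"
    using p by (auto simp: path_edges_snoc joining_path_iff)
  moreover have "c \<noteq> s"
    using p pc by (cases p) (auto simp: joining_path_iff)
  ultimately show ?thesis
    unfolding alt_set_iff[OF pc] by (auto simp: alternating_iff successively_append_iff)
qed

text \<open>Of two adjacent vertices one precedes the other on its path from \<open>s\<close>. If
  both were in the set, two consecutive edges of that path would be in \<open>P\<close>.\<close>

lemma alt_set_independent:
  assumes "t \<in> alt_set S R P s" "u \<in> alt_set S R P s"
  shows "{t, u} \<notin> R"
proof
  assume tu: "{t, u} \<in> R"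
  have "t \<in> S" "u \<in> S" "s \<noteq> t" "s \<noteq> u"
    using assms alt_set_subset by blast+
  have "s \<in> S"
    using assms(1) by (auto simp: alt_set_def joining_path_iff)
  obtain p where p: "joining_path S R s p t"
    using tree_connected[OF tree \<open>s \<in> S\<close> \<open>t \<in> S\<close>] by blast
  obtain p' t0 where p': "p = p' @ [t]" "joining_path S R s p' t0"
    "\<And>c. {t, c} \<in> R \<Longrightarrow> c \<noteq> t0 \<Longrightarrow> joining_path S R s (p @ [c]) c"
    using path_lastE[OF p \<open>s \<noteq> t\<close>] by metis
  show False
  proof (cases "u = t0")
    case True
    then have "t \<in> alt_set S R P s \<longleftrightarrow> {u, t} \<in> P \<and> alternating P p' \<and> hd (path_edges p') \<in> P \<and>
        last (path_edges p') \<notin> P"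
      using alt_set_beyond[of s p' u t] p p' \<open>s \<noteq> u\<close> by simp
    then show False
      using assms alt_set_iff[of s p' u] p' True by blast
  next
    case False
    then show False
      using alt_set_beyond[OF p \<open>s \<noteq> t\<close> p'(3)[OF tu]] alt_set_iff[OF p] assms by blast
  qed
qed

text \<open>The indicator vectors of the sets \<open>A_s\<close> are thus the rows of the inverse of
  the adjacency matrix modulo 2. For \<open>t\<close> distinct from \<open>s\<close>, only the
  predecessor of \<open>t\<close> and the partner of \<open>t\<close> can be neighbors of
  \<open>t\<close> in the set, and either both are or neither is.\<close>

lemma odd_neighbors_in_alt_set:
  assumes st: "s \<in> S" "t \<in> S"
  shows "odd (card {u \<in> alt_set S R P s. {t, u} \<in> R}) \<longleftrightarrow> s = t"
proof (cases "s = t")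
  case True
  obtain s' where s': "{s, s'} \<in> P"
    using partner_exists[OF st(1)] .
  have "{u \<in> alt_set S R P s. {t, u} \<in> R} = {s'}"
    using True s' alt_set_adjacent matching_unique matching_edge by blast
  then show ?thesis
    using True by simp
next
  case False
  let ?N = "{u \<in> alt_set S R P s. {t, u} \<in> R}"
  obtain p where p: "joining_path S R s p t"
    using tree_connected[OF tree st] by blast
  obtain p' t0 where p': "p = p' @ [t]" "joining_path S R s p' t0" "{t, t0} \<in> R" "t0 \<noteq> t"
    "path_edges p = path_edges p' @ [{t, t0}]"
    "\<And>c. {t, c} \<in> R \<Longrightarrow> c \<noteq> t0 \<Longrightarrow> joining_path S R s (p @ [c]) c"
    using path_lastE[OF p False] by metis
  obtain t' where t': "{t, t'} \<in> P"
    using partner_exists[OF st(2)] .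
  have beyond: "c \<in> alt_set S R P s \<longleftrightarrow> c = t' \<and> alternating P p \<and> hd (path_edges p) \<in> P \<and> {t, t0} \<notin> P"
    if "{t, c} \<in> R" "c \<noteq> t0" for c
    using alt_set_beyond[OF p False p'(6)[OF that]] p'(5) t' matching_unique by auto
  have t0: "t0 \<in> alt_set S R P s \<longleftrightarrow> t0 \<noteq> s \<and> alternating P p' \<and> hd (path_edges p') \<in> P \<and>
      last (path_edges p') \<in> P"
    by (rule alt_set_iff[OF p'(2)])
  have "even (card ?N)"
  proof (cases "{t, t0} \<in> P")
    case True
    \<comment> \<open>Otherwise the path to \<open>t0\<close> would end with the matching edge at
      \<open>t0\<close>, which leads to \<open>t\<close>, and \<open>t\<close> would occur twice on
      \<open>p\<close>.\<close>
    have "t0 \<notin> alt_set S R P s"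
    proof
      assume t0A: "t0 \<in> alt_set S R P s"
      then have "s \<noteq> t0"
        using alt_set_subset by blast
      have "t \<in> set p"
        using p' by simp
      obtain q t1 where q: "p' = q @ [t0]" "joining_path S R s q t1"
        "path_edges p' = path_edges q @ [{t0, t1}]"
        using path_lastE[OF p'(2) \<open>s \<noteq> t0\<close>] by metis
      then have "{t0, t1} \<in> P"
        using t0A t0 by simp
      then have "t1 = t"
        using True matching_unique[of t0 t1 t] by (simp add: insert_commute)
      then show False
        using q p p'(1) by (auto simp: joining_path_iff)
    qed
    then have "?N = {}"
      using beyond True by blast
    show ?thesis unfolding \<open>?N = {}\<close> by simp
  next
    case False
    have "t' \<noteq> t0"
      using False t' by blast
    \<comment> \<open>As the last edge is outside \<open>P\<close>, alternation forces the edge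
      before it into \<open>P\<close>, which is the condition for \<open>t0\<close>.\<close>
    have "alternating P p \<and> hd (path_edges p) \<in> P \<longleftrightarrow> t0 \<in> alt_set S R P s"
    proof (cases "s = t0")
      case True
      then have "p' = [s]"
        using unique_path[OF tree p'(2)] path_single[OF tree, of s] st by simp
      then show ?thesis
        using t0 True False p'(5) by simp
    next
      case neq: False
      then have "path_edges p' \<noteq> []"
        using p'(2) by (cases p' rule: path_edges.cases) (auto simp: joining_path_iff)
      then show ?thesis
        using t0 neq False p'(5) by (auto simp: alternating_iff successively_append_iff)
    qed
    then consider "?N = {}" | "?N = {t0, t'}"
      using beyond[of t'] beyond t' matching_edge \<open>t' \<noteq> t0\<close> p'(3) False by blast
    then show ?thesis
    proof cases
      case 1
      show ?thesis unfolding 1 by simp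
    next
      case 2
      show ?thesis unfolding 2 using \<open>t' \<noteq> t0\<close> by simp
    qed
  qed
  then show ?thesis
    using False by simp
qed

end

section \<open>The game on a path\<close>

lemma odd_card_sym_diff:
  assumes "finite A" "finite B"
  shows "odd (card (sym_diff A B)) \<longleftrightarrow> odd (card A) \<noteq> odd (card B)"
proof -
  have "card A = card (A - B) + card (A \<inter> B)" "card B = card (B - A) + card (A \<inter> B)"
    using assms by (metis card_Diff_subset_Int card_mono finite_Int inf_commute inf_le1 le_add_diff_inverse2)+
  moreover have "card (sym_diff A B) = card (A - B) + card (B - A)"
    using assms by (intro card_Un_disjoint) auto
  ultimately show ?thesis
    by presburger
qed

text \<open>The parity of the number of on vertices below position \<open>k\<close> colors the gaps of the path with two
  colors, and a move swaps the colors of two adjacent gaps. Sorting the colors leaves at most one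
  vertex on.\<close>

lemma path_one_lit:
  assumes l: "distinct l"
  shows "k_lit 1 (set l) (set (path_edges l))"
proof -
  let ?n = "length l" and ?S = "set l" and ?R = "set (path_edges l)"
  have adj: "{l ! i, l ! j} \<in> ?R \<longleftrightarrow> j = Suc i \<or> i = Suc j" if "i < ?n" "j < ?n" for i j
  proof -
    have "{l ! i, l ! j} \<in> ?R \<longleftrightarrow> (\<exists>k. Suc k < ?n \<and> {l ! i, l ! j} = {l ! k, l ! Suc k})"
      unfolding in_set_conv_nth length_path_edges using path_edges_nth[of _ l]
      by (metis One_nat_def Suc_eq_plus1 less_diff_conv)
    also have "\<dots> \<longleftrightarrow> j = Suc i \<or> i = Suc j"
      using that nth_eq_iff_index_eq[OF l] by (auto simp: doubleton_eq_iff)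
    finally show ?thesis .
  qed
  define below where "below C k = {i. i < k \<and> l ! i \<in> C}" for C k
  \<comment> \<open>Each odd gap \<open>k\<close> weighs its distance to the right end. Swapping an
    odd gap with the even gap to its right lowers the sum by one.\<close>
  define M where "M C = (\<Sum>k\<le>?n. if odd (card (below C k)) then ?n - k else 0)" for C
  have fin [simp]: "finite (below C k)" for C k
    by (rule finite_subset[of _ "{..<k}"]) (auto simp: below_def)
  have below_Suc: "card (below C (Suc k)) = card (below C k) + (if l ! k \<in> C then 1 else 0)" for C k
  proof -
    have "below C (Suc k) = (if l ! k \<in> C then insert k (below C k) else below C k)"
      by (auto simp: below_def less_Suc_eq)
    moreover have "k \<notin> below C k"
      by (simp add: below_def)
    ultimately show ?thesis
      by simp
  qed
  have "\<exists>D. (lit_move ?S ?R)\<^sup>*\<^sup>* C D \<and> card D \<le> 1" if "C \<subseteq> ?S" for C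
    using that
  proof (induction "M C" arbitrary: C rule: less_induct)
    case less
    show ?case
    proof (cases "\<exists>i<?n. l ! i \<in> C \<and> odd (card (below C i))")
      case True
      then obtain i where i: "i < ?n" "l ! i \<in> C" "odd (card (below C i))"
        by blast
      \<comment> \<open>Nothing lies below gap 0, so it is always even, and \<open>i - 1\<close> is
        a genuine position.\<close>
      have "i \<noteq> 0"
        using i(3) by (intro notI) (simp add: below_def)
      define D where "D = sym_diff C (neighbors ?S ?R (l ! i))"
      have move: "lit_move ?S ?R C D"
        using i(2) by (auto simp: lit_move_def D_def)
      have "D \<subseteq> ?S"
        using less.prems by (auto simp: D_def neighbors_def)
      \<comment> \<open>The move changes positions \<open>i - 1\<close> and \<open>i + 1\<close>;
        only the gaps \<open>i\<close> and \<open>i + 1\<close> have exactly one changed position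
        below them.\<close>
      have parity: "odd (card (below D k)) \<longleftrightarrow> odd (card (below C k)) \<noteq> (k = i \<or> k = Suc i)"
        if "k \<le> ?n" for k
      proof -
        let ?N = "{j. j < k \<and> (j = Suc i \<or> i = Suc j)}"
        have "below D k = sym_diff (below C k) ?N"
          using that i(1) adj[of i] by (auto simp: below_def D_def neighbors_def)
        moreover have "?N = (if k < i then {} else if k \<le> Suc i then {i - 1} else {i - 1, Suc i})"
          using \<open>i \<noteq> 0\<close> by auto
        then have "finite ?N" "odd (card ?N) \<longleftrightarrow> k = i \<or> k = Suc i"
          by (auto simp: le_Suc_eq)
        ultimately show ?thesis
          using odd_card_sym_diff[OF fin, of ?N C k] by simp
      qed
      let ?f = "\<lambda>C k. if odd (card (below C k)) then ?n - k else 0"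
      have split: "M C = ?f C i + (?f C (Suc i) + sum (?f C) ({..?n} - {i} - {Suc i}))" for C
      proof -
        have "i \<in> {..?n}" "Suc i \<in> {..?n} - {i}"
          using i(1) by auto
        then show ?thesis
          unfolding M_def
          by (simp only: sum.remove[of "{..?n}" i] sum.remove[of "{..?n} - {i}" "Suc i"]
              finite_atMost finite_Diff)
      qed
      have "sum (?f D) ({..?n} - {i} - {Suc i}) = sum (?f C) ({..?n} - {i} - {Suc i})"
        by (rule sum.cong) (auto simp: parity)
      moreover have "even (card (below C (Suc i)))"
        using i(2,3) by (simp add: below_Suc)
      ultimately have "M D < M C"
        using i(1,3) parity[of i] parity[of "Suc i"] unfolding split by simp
      then obtain D' where "(lit_move ?S ?R)\<^sup>*\<^sup>* D D'" "card D' \<le> 1"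
        using less.hyps \<open>D \<subseteq> ?S\<close> by blast
      then show ?thesis
        using move by (meson converse_rtranclp_into_rtranclp)
    next
      case False
      \<comment> \<open>Beyond the first on vertex the count is odd, so no further on vertex can
        follow.\<close>
      have "card (below C k) \<le> 1" if "k \<le> ?n" for k
        using that
      proof (induction k)
        case 0
        then show ?case by (simp add: below_def)
      next
        case (Suc k)
        then show ?case
          using False by (cases "card (below C k)") (auto simp: below_Suc)
      qed
      moreover have "(!) l ` below C ?n = C"
        using less.prems by (auto simp: below_def image_iff in_set_conv_nth subset_iff)
      then have "card C = card (below C ?n)"
        using card_image[of "(!) l" "below C ?n"] l by (auto simp: below_def inj_on_def nth_eq_iff_index_eq)
      ultimately show ?thesis
        by (metis order_refl rtranclp.rtrancl_refl)
    qed
  qed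
  then show ?thesis
    unfolding k_lit_def by blast
qed

lemma subdivided_path_one_lit:
  assumes l: "distinct l" "z \<notin> set l" and xy: "{x, y} \<in> set (path_edges l)"
  shows "k_lit 1 (insert z (set l)) ((set (path_edges l) - {{x, y}}) \<union> {{x, z}, {y, z}})"
proof -
  obtain i where i: "Suc i < length l" "{x, y} = {l ! i, l ! Suc i}"
    using xy path_edges_nth[of _ l] unfolding in_set_conv_nth length_path_edges
    by (metis One_nat_def Suc_eq_plus1 less_diff_conv)
  define a b where "a = l ! i" and "b = l ! Suc i"
  define l1 l2 where "l1 = take i l" and "l2 = drop (Suc (Suc i)) l"
  have l12: "l = l1 @ a # b # l2"
    unfolding l1_def l2_def a_def b_def using i(1)
    by (simp add: Cons_nth_drop_Suc id_take_nth_drop)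
  let ?l = "l1 @ a # z # b # l2"
  have pe: "path_edges (l1 @ a # m) = path_edges (l1 @ [a]) @ path_edges (a # m)" for m
    by (rule path_edges_append_Cons)
  \<comment> \<open>Distinctness of \<open>l\<close> makes the edge occur only once, so removing it
    leaves the other edges of the path.\<close>
  have "{a, b} \<notin> set (path_edges (l1 @ [a]))" "{a, b} \<notin> set (path_edges (b # l2))"
    using path_edges_in_set[of "{a, b}"] l(1) l12 by fastforce+
  moreover have "{x, y} = {a, b}"
    using i(2) by (simp add: a_def b_def)
  moreover from this have "{{x, z}, {y, z}} = {{a, z}, {z, b}}"
    by (auto simp: doubleton_eq_iff insert_commute)
  ultimately have "set (path_edges ?l) = (set (path_edges l) - {{x, y}}) \<union> {{x, z}, {y, z}}"
    unfolding l12 pe[of "z # b # l2"] pe[of "b # l2"] by auto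
  moreover have "set ?l = insert z (set l)" "distinct ?l"
    using l l12 by auto
  ultimately show ?thesis
    using path_one_lit[of ?l] by simp
qed

section \<open>The subdivided tree\<close>

locale subdivided_tree =
  fixes S :: "'a set" and R P :: "'a set set" and x y z :: 'a
  assumes tree: "finite_tree S R" and matching: "perfect_matching S R P"
    and xy: "{x, y} \<in> R" and z: "z \<notin> S"
begin

abbreviation "W \<equiv> insert z S"
definition "E = (R - {{x, y}}) \<union> {{x, z}, {y, z}}"
abbreviation B :: "('a \<Rightarrow> bit) \<Rightarrow> ('a \<Rightarrow> bit) \<Rightarrow> bool" where "B u v \<equiv> bform W E u v = 1"
abbreviation Q :: "('a \<Rightarrow> bit) \<Rightarrow> bool" where "Q v \<equiv> qform W E v = 1"

lemma xyS: "x \<in> S" "y \<in> S" "x \<noteq> y" "x \<noteq> z" "y \<noteq> z" "z \<noteq> x" "z \<noteq> y"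
  using edge_in[OF tree xy] z by auto

lemma finite_S: "finite S" and edge_S: "e \<in> R \<Longrightarrow> e \<subseteq> S"
  using tree_graph[OF tree] by (auto simp: finite_simple_graph_def)

lemma hat_graph: "finite_simple_graph W E"
  using tree_graph[OF tree] xyS by (auto simp: finite_simple_graph_def E_def)

sublocale f2_quadratic B Q "roots W E"
  by (rule f2_quadratic_graph[OF hat_graph])

text \<open>Adding \<open>z\<close> to \<open>x\<close> restores the adjacency of \<open>x\<close> and \<open>y\<close>: the vectors \<open>vec s\<close> have the Gram matrix of
  the original tree.\<close>

definition vec :: "'a \<Rightarrow> 'a \<Rightarrow> bit" where
  "vec s = (if s = x then single x + single z else single s)"

abbreviation "V \<equiv> span (vec ` S)"

lemma B_single: "s \<in> W \<Longrightarrow> t \<in> W \<Longrightarrow> B (single s) (single t) \<longleftrightarrow> {s, t} \<in> E"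
  using finite_S by (simp add: bform_single)

lemma edge_hat:
  assumes "s \<in> S" "t \<in> S"
  shows "{s, t} \<in> E \<longleftrightarrow> {s, t} \<in> R \<and> {s, t} \<noteq> {x, y}" "{z, t} \<in> E \<longleftrightarrow> t = x \<or> t = y"
    "{t, z} \<in> E \<longleftrightarrow> t = x \<or> t = y"
  using assms z xyS edge_S[of "{z, t}"] by (auto simp: E_def doubleton_eq_iff insert_commute)

lemma B_vec:
  assumes "s \<in> S" "t \<in> S"
  shows "B (vec s) (vec t) \<longleftrightarrow> {s, t} \<in> R"
proof -
  have B: "B (single s) (single t) \<longleftrightarrow> {s, t} \<in> R \<and> {s, t} \<noteq> {x, y}"
    "B (single z) (single t) \<longleftrightarrow> t = x \<or> t = y" "B (single s) (single z) \<longleftrightarrow> s = x \<or> s = y"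
    using B_single[of s t] B_single[of z t] B_single[of s z] edge_hat[OF assms] edge_hat[OF assms(2,1)] assms
    by auto
  consider "s = x" "t = x" | "s = x" "t \<noteq> x" | "s \<noteq> x" "t = x" | "s \<noteq> x" "t \<noteq> x"
    by blast
  then show ?thesis
  proof cases
    case 1
    have "{x, x} \<notin> R"
      using edge_in[OF tree] by blast
    then show ?thesis
      unfolding 1 by simp
  next
    case 2
    then have "B (vec s) (vec t) \<longleftrightarrow> B (single s) (single t) \<noteq> B (single z) (single t)"
      by (simp add: vec_def B_add)
    then show ?thesis
      using 2 B xy by (auto simp: doubleton_eq_iff)
  next
    case 3
    then have "B (vec s) (vec t) \<longleftrightarrow> B (single s) (single t) \<noteq> B (single s) (single z)"
      by (simp add: vec_def B_add_right)
    then show ?thesis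
      using 3 B xy by (auto simp: doubleton_eq_iff insert_commute)
  next
    case 4
    then show ?thesis
      using B(1) by (auto simp: vec_def doubleton_eq_iff)
  qed
qed

lemma B_z_vec:
  assumes "t \<in> S"
  shows "B (single z) (vec t) \<longleftrightarrow> t = x \<or> t = y"
proof -
  have "B (single z) (single t) \<longleftrightarrow> t = x \<or> t = y"
    using B_single[of z t] edge_hat(2)[OF assms assms] assms by blast
  then show ?thesis
    by (cases "t = x") (simp_all add: vec_def B_add_right)
qed

lemma Q_single: "s \<in> W \<Longrightarrow> Q (single s)"
  using qform_single[OF hat_graph] by blast

lemma B_x_z: "B (single x) (single z)"
  using B_single[of x z] xyS by (auto simp: E_def)

lemma Q_vec: "s \<in> S \<Longrightarrow> Q (vec s)"
  using Q_single[of s] Q_single[of z] B_x_z xyS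
  by (auto simp: vec_def Q_add)

lemma vec_root: "s \<in> S \<Longrightarrow> vec s \<in> roots W E"
  using roots.single[of s W E] roots.single[of z W E] D_add[of "single x" "single z"] B_x_z xyS
  by (auto simp: vec_def)

lemma vec_in_V: "s \<in> S \<Longrightarrow> vec s \<in> V"
  by (intro span_base imageI)

lemma additive_eq_on_V:
  assumes "additive_on V f" "additive_on V g" "\<And>s. s \<in> S \<Longrightarrow> f (vec s) \<longleftrightarrow> g (vec s)" "v \<in> V"
  shows "f v \<longleftrightarrow> g v"
  using assms(4)
proof induction
  case span_0
  have "\<not> h 0" if "additive_on V h" for h
    using that span.span_0[of "vec ` S"] unfolding additive_on_def by (metis add_0)
  then show ?case
    using assms(1,2) by blast
next
  case (span_add_base u v)
  then have "u \<in> V"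
    by (simp add: span_base)
  then show ?case
    using span_add_base assms(1-3) unfolding additive_on_def by blast
qed

section \<open>The dual basis and the radical\<close>

definition \<omega> :: "'a \<Rightarrow> 'a \<Rightarrow> bit" where
  "\<omega> s = (\<Sum>t\<in>alt_set S R P s. vec t)"

lemma finite_alt_set: "finite (alt_set S R P s)"
  using finite_subset[OF alt_set_subset[OF tree matching, of s]] finite_S by blast

lemma sum_vec_in_V: "finite A \<Longrightarrow> A \<subseteq> S \<Longrightarrow> (\<Sum>t\<in>A. vec t) \<in> V"
proof (induction rule: finite_induct)
  case empty
  show ?case
    unfolding sum.empty by (rule span_0)
next
  case (insert a A)
  then show ?case
    unfolding sum.insert[OF insert(1,2)] by (intro span_add_base imageI) auto
qed

lemma \<omega>_in_V: "\<omega> s \<in> V"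
  unfolding \<omega>_def using alt_set_subset[OF tree matching, of s] by (intro sum_vec_in_V finite_alt_set) auto

lemma B_\<omega>_vec:
  assumes "s \<in> S" "t \<in> S"
  shows "B (\<omega> s) (vec t) \<longleftrightarrow> s = t"
proof -
  have "{u \<in> alt_set S R P s. B (vec u) (vec t)} = {u \<in> alt_set S R P s. {t, u} \<in> R}"
    using alt_set_subset[OF tree matching, of s] B_vec assms(2) by (auto simp: insert_commute)
  then show ?thesis
    unfolding \<omega>_def B_sum[OF finite_alt_set]
    using odd_neighbors_in_alt_set[OF tree matching assms] by (simp only:)
qed

text \<open>Pairing with \<open>\<omega> s\<close> tests whether \<open>vec s\<close> is a summand
  of \<open>\<omega> t\<close>.\<close>

lemma B_\<omega>_\<omega>:
  assumes "s \<in> S" "t \<in> S"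
  shows "B (\<omega> s) (\<omega> t) \<longleftrightarrow> s \<in> alt_set S R P t"
proof -
  have "{u \<in> alt_set S R P t. B (vec u) (\<omega> s)} = (if s \<in> alt_set S R P t then {s} else {})"
    using alt_set_subset[OF tree matching, of t] B_\<omega>_vec[OF assms(1)] B_sym by auto
  then have "B (\<omega> t) (\<omega> s) \<longleftrightarrow> s \<in> alt_set S R P t"
    unfolding \<omega>_def[of t] B_sum[OF finite_alt_set] by (simp only: split: if_split) simp
  then show ?thesis
    using B_sym by blast
qed

text \<open>The summands have value 1 and are pairwise orthogonal, since \<open>A_s\<close> is an
  independent set.\<close>

lemma Q_\<omega>: "Q (\<omega> s) \<longleftrightarrow> odd (card (alt_set S R P s))"
  unfolding \<omega>_def
proof (rule Q_sum[OF finite_alt_set])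
  show "\<not> B (vec t) (vec u)" if "t \<in> alt_set S R P s" "u \<in> alt_set S R P s" for t u
    using alt_set_independent[OF tree matching that] B_vec[of t u] that alt_set_subset[OF tree matching, of s] by blast
  show "Q (vec t)" if "t \<in> alt_set S R P s" for t
    using that alt_set_subset[OF tree matching, of s] by (intro Q_vec) blast
qed

lemma \<omega>_neq_0: "s \<in> S \<Longrightarrow> \<omega> s \<noteq> 0"
  using B_\<omega>_vec[of s s] by auto

text \<open>The vector \<open>single z + \<rho>\<close> spans the radical.\<close>

definition \<rho> :: "'a \<Rightarrow> bit" where
  "\<rho> = \<omega> x + \<omega> y"

lemma \<rho>_in_V: "\<rho> \<in> V"
  unfolding \<rho>_def by (intro subspace_add[OF subspace_span] \<omega>_in_V)

lemma B_\<rho>_vec: "t \<in> S \<Longrightarrow> B \<rho> (vec t) \<longleftrightarrow> t = x \<or> t = y"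
  using B_\<omega>_vec xyS by (auto simp: \<rho>_def B_add)

text \<open>Both vectors pair to 1 with \<open>vec x\<close> and \<open>vec y\<close> and with no
  other basis vector; so \<rho> represents \<open>z\<close> on \<open>V\<close>.\<close>

lemma B_\<rho>: "v \<in> V \<Longrightarrow> B \<rho> v \<longleftrightarrow> B (single z) v"
  by (rule B_span_cong) (auto simp: B_\<rho>_vec B_z_vec)

lemma \<rho>_neq_0: "\<rho> \<noteq> 0"
  using B_\<rho>_vec[of x] xyS by auto

section \<open>Configurations as functionals\<close>

lemma coordinate:
  assumes "s \<in> S" "v \<in> V"
  shows "v s = 1 \<longleftrightarrow> B (\<omega> s) v"
proof (rule additive_eq_on_V[OF _ additive_on_B _ assms(2)])
  show "additive_on V (\<lambda>v. v s = 1)"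
    by (auto simp: additive_on_def bit_add_eq_1_iff)
  show "vec t s = 1 \<longleftrightarrow> B (\<omega> s) (vec t)" if "t \<in> S" for t
    using B_\<omega>_vec[OF assms(1) that] assms(1) z xyS by (auto simp: vec_def single_def)
qed

text \<open>Only \<open>vec x\<close> involves \<open>z\<close>, so on \<open>V\<close> the
  coordinates at \<open>z\<close> and at \<open>x\<close> agree.\<close>

lemma coordinate_z:
  assumes "v \<in> V"
  shows "v z = 1 \<longleftrightarrow> B (\<omega> x) v"
proof (rule additive_eq_on_V[OF _ additive_on_B _ assms])
  show "additive_on V (\<lambda>v. v z = 1)"
    by (auto simp: additive_on_def bit_add_eq_1_iff)
  show "vec t z = 1 \<longleftrightarrow> B (\<omega> x) (vec t)" if "t \<in> S" for t
    using B_\<omega>_vec[OF xyS(1) that] that z xyS by (auto simp: vec_def single_def)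
qed

lemma lit_value_add: "lit_value C (u + v) = lit_value C u + lit_value C v"
  by (simp add: lit_value_def sum.distrib)

text \<open>The functional of a configuration is represented on \<open>V\<close> by some \<open>\<theta>\<close>, and \<open>\<kappa>\<close> is its value on the
  radical, which no move changes.\<close>

definition state :: "'a set \<Rightarrow> ('a \<Rightarrow> bit) \<Rightarrow> bool \<Rightarrow> bool" where
  "state C \<theta> \<kappa> \<longleftrightarrow> \<theta> \<in> V \<and> (\<forall>v\<in>V. lit_value C v = 1 \<longleftrightarrow> B \<theta> v) \<and>
     (lit_value C (single z + \<rho>) = 1 \<longleftrightarrow> \<kappa>)"

text \<open>\<open>V\<close> and the radical vector together span everything:
  \<open>single z\<close> is the radical vector plus \<rho>, and \<open>single x\<close> is
  \<open>vec x\<close> plus \<open>single z\<close>.\<close>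

lemma state_unique:
  assumes "state C \<theta> \<kappa>" "state C' \<theta> \<kappa>" "C \<subseteq> W" "C' \<subseteq> W"
  shows "C = C'"
proof -
  have eq: "lit_value C v = lit_value C' v" if "v \<in> V" for v
  proof -
    have "lit_value C v = 1 \<longleftrightarrow> lit_value C' v = 1"
      using assms(1,2) that unfolding state_def by blast
    then show ?thesis
      by (cases "lit_value C v"; cases "lit_value C' v") auto
  qed
  have "lit_value C (single z + \<rho>) = 1 \<longleftrightarrow> lit_value C' (single z + \<rho>) = 1"
    using assms(1,2) unfolding state_def by blast
  then have z_eq: "lit_value C (single z) = lit_value C' (single z)"
    using eq[OF \<rho>_in_V] unfolding lit_value_add
    by (cases "lit_value C (single z)"; cases "lit_value C' (single z)"; cases "lit_value C' \<rho>") auto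
  have "lit_value C (single s) = lit_value C' (single s)" if s: "s \<in> W" for s
  proof (cases "s = x \<or> s = z")
    case True
    have "single x = vec x + single z"
      by (simp only: vec_def if_True simp_thms add.assoc double add_0_right)
    then show ?thesis
      using True eq[OF vec_in_V[OF xyS(1)]] z_eq by (auto simp: lit_value_add)
  next
    case False
    then show ?thesis
      using s eq[OF vec_in_V, of s] by (simp add: vec_def)
  qed
  then show ?thesis
    using config_eqI[OF hat_graph assms(3,4)] by blast
qed

lemma state_single:
  assumes "s \<in> S"
  shows "state {s} (\<omega> s) (B (\<omega> s) \<rho>)"
  using coordinate[OF assms] \<omega>_in_V \<rho>_in_V assms z
  by (auto simp: state_def lit_value_def single_def)

text \<open>On \<open>V\<close> the configuration \<open>{z}\<close> cannot be told from
  \<open>{x}\<close>; only the value on the radical differs.\<close>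

lemma state_z: "state {z} (\<omega> x) (\<not> B (\<omega> x) \<rho>)"
  using coordinate_z coordinate_z[OF \<rho>_in_V] \<omega>_in_V
  by (auto simp: state_def lit_value_def single_def bit_add_eq_1_iff)

lemma state_Un:
  assumes "state C \<theta> \<kappa>" "state C' \<theta>' \<kappa>'" "C \<inter> C' = {}" "finite C" "finite C'"
  shows "state (C \<union> C') (\<theta> + \<theta>') (\<kappa> \<noteq> \<kappa>')"
proof -
  have "lit_value (C \<union> C') v = lit_value C v + lit_value C' v" for v
    unfolding lit_value_def using assms(3-5) by (simp add: sum.union_disjoint)
  then show ?thesis
    using assms(1,2) subspace_add[OF subspace_span] by (simp add: state_def bit_add_eq_1_iff B_add)
qed

lemma state_empty: "state {} 0 False"
  by (auto simp: state_def lit_value_def span_0)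

lemma B_radical: "v \<in> V \<Longrightarrow> \<not> B v (single z + \<rho>)" "\<not> B (single z) (single z + \<rho>)"
proof -
  show "\<not> B v (single z + \<rho>)" if "v \<in> V"
    using B_\<rho>[OF that] B_sym[of v \<rho>] B_sym[of v "single z"] by (auto simp: B_add_right)
  show "\<not> B (single z) (single z + \<rho>)"
    using B_\<rho>[OF \<rho>_in_V] by (auto simp: B_add_right)
qed

text \<open>\<open>d\<close> need not lie in \<open>V\<close>, since \<open>\<theta>'\<close> stands
  for it there. This form serves both roots of \<open>V\<close> and the move at
  \<open>z\<close>.\<close>

lemma state_flip:
  assumes "state C \<theta> \<kappa>" "C \<subseteq> W" "\<theta>' \<in> V" "\<And>v. v \<in> V \<Longrightarrow> B d v \<longleftrightarrow> B \<theta>' v" "\<not> B d (single z + \<rho>)"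
  shows "state (flip W E d C) (\<theta> + \<theta>') \<kappa>"
proof -
  have "finite C"
    using finite_subset[OF assms(2)] finite_S by simp
  then show ?thesis
    using assms subspace_add[OF subspace_span]
    by (simp add: state_def lit_value_flip[OF hat_graph] bit_add_eq_1_iff B_add)
qed

text \<open>The hypothesis says that \<open>z\<close> is on: \<open>single z\<close> is the radical
  vector plus \<rho>, with values \<kappa> and \<open>B \<theta> \<rho>\<close>.\<close>

lemma z_move:
  assumes "state C \<theta> \<kappa>" "C \<subseteq> W" "\<kappa> \<noteq> B \<theta> \<rho>"
  shows "\<exists>C'\<subseteq>W. (lit_move W E)\<^sup>*\<^sup>* C C' \<and> state C' (\<theta> + \<rho>) \<kappa>"
proof -
  have "lit_value C (single z) = 1"
    using assms(1,3) \<rho>_in_V by (auto simp: state_def lit_value_add bit_add_eq_1_iff)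
  then have "(lit_move W E)\<^sup>*\<^sup>* C (flip W E (single z) C)"
    by (intro lit_move_root[OF hat_graph] assms(2) roots.single) simp_all
  then show ?thesis
    using state_flip[OF assms(1,2) \<rho>_in_V, of "single z"] B_\<rho> B_radical(2) flip_subset[OF hat_graph assms(2)]
    by blast
qed

end

locale branching_subdivided_tree = subdivided_tree +
  assumes full: "full (vec ` S)"
begin

lemma V: "nondegenerate V" "self_dual V" "three_planes V" "v \<in> V \<Longrightarrow> Q v \<Longrightarrow> v \<in> roots W E"
  using full unfolding full_def by blast+

lemma exists_state: "\<exists>\<theta> \<kappa>. state C \<theta> \<kappa>"
proof -
  have "additive_on V (\<lambda>v. lit_value C v = 1)"
    by (auto simp: additive_on_def lit_value_add bit_add_eq_1_iff)
  then show ?thesis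
    using V(2) unfolding self_dual_def state_def by blast
qed

text \<open>Each \<open>d\<close> in \<open>V\<close> with \<open>Q d\<close> is a root, so the
  transvection in \<open>d\<close> is realized by moves, and \<open>orbit_induct\<close> gives
  transitivity.\<close>

lemma orbit:
  assumes "state C \<theta> \<kappa>" "C \<subseteq> W" "\<theta> \<noteq> 0" "\<theta>' \<in> V" "\<theta>' \<noteq> 0" "Q \<theta> = Q \<theta>'"
  shows "\<exists>C'\<subseteq>W. (lit_move W E)\<^sup>*\<^sup>* C C' \<and> state C' \<theta>' \<kappa>"
proof (rule orbit_induct[where v = \<theta> and V = V, OF subspace_span V(3,1)])
  show "\<theta> \<in> V"
    using assms(1) by (simp add: state_def)
  show "\<exists>C'\<subseteq>W. (lit_move W E)\<^sup>*\<^sup>* C C' \<and> state C' \<theta> \<kappa>"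
    using assms(1,2) by blast
  show "\<exists>C'\<subseteq>W. (lit_move W E)\<^sup>*\<^sup>* C C' \<and> state C' (u + d) \<kappa>"
    if ud: "u \<in> V" "d \<in> V" "Q d" "B u d" and IH: "\<exists>C'\<subseteq>W. (lit_move W E)\<^sup>*\<^sup>* C C' \<and> state C' u \<kappa>" for u d
  proof -
    obtain C' where C': "C' \<subseteq> W" "(lit_move W E)\<^sup>*\<^sup>* C C'" "state C' u \<kappa>"
      using IH by blast
    have "lit_value C' d = 1"
      using C'(3) ud(2,4) by (simp add: state_def)
    then have "(lit_move W E)\<^sup>*\<^sup>* C' (flip W E d C')"
      by (rule lit_move_root[OF hat_graph V(4)[OF ud(2,3)] C'(1)])
    moreover have "state (flip W E d C') (u + d) \<kappa>"
      using state_flip[OF C'(3,1) ud(2)] B_radical(1)[OF ud(2)] by blast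
    ultimately show ?thesis
      using C'(2) flip_subset[OF hat_graph C'(1)] by (meson rtranclp_trans)
  qed
qed (use assms in auto)

text \<open>The case \<open>\<theta> = 0\<close> is excluded because it forms separate orbits of the moves along \<open>V\<close>.\<close>

definition reducible :: "nat \<Rightarrow> bool \<Rightarrow> bool \<Rightarrow> bool" where
  "reducible k c \<kappa> \<longleftrightarrow> (\<forall>C \<theta>. C \<subseteq> W \<longrightarrow> state C \<theta> \<kappa> \<longrightarrow> \<theta> \<noteq> 0 \<longrightarrow> Q \<theta> = c \<longrightarrow>
     (\<exists>D. (lit_move W E)\<^sup>*\<^sup>* C D \<and> card D \<le> k))"

text \<open>A state determines its configuration, and each class is one orbit, so a single
  configuration with few lights settles the class.\<close>

lemma reducibleI:
  assumes "state D \<theta>' \<kappa>" "D \<subseteq> W" "card D \<le> k" "\<theta>' \<noteq> 0" "Q \<theta>' = c"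
  shows "reducible k c \<kappa>"
  unfolding reducible_def
proof (intro allI impI)
  fix C \<theta> assume C: "C \<subseteq> W" "state C \<theta> \<kappa>" "\<theta> \<noteq> 0" "Q \<theta> = c"
  have "\<theta>' \<in> V"
    using assms(1) by (simp add: state_def)
  then obtain C' where "C' \<subseteq> W" "(lit_move W E)\<^sup>*\<^sup>* C C'" "state C' \<theta>' \<kappa>"
    using orbit[OF C(2,1,3) _ assms(4)] C(4) assms(5) by blast
  moreover have "C' = D"
    using state_unique[OF _ assms(1) _ assms(2)] calculation by blast
  ultimately show "\<exists>D. (lit_move W E)\<^sup>*\<^sup>* C D \<and> card D \<le> k"
    using assms(3) by blast
qed

text \<open>One first moves to some \<open>t\<close> with \<open>B \<rho> t\<close> opposite to
  \<kappa>, so that \<open>z\<close> is on. The move at \<open>z\<close> gives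
  \<open>t + \<rho>\<close>, and \<open>Q \<rho> = \<kappa>\<close> makes the value of
  \<open>Q\<close> change. The condition \<open>t \<noteq> \<rho>\<close> keeps the result
  nonzero.\<close>

lemma reducible_merge:
  assumes "reducible k (\<not> c) \<kappa>" "Q \<rho> = \<kappa>"
  shows "reducible k c \<kappa>"
  unfolding reducible_def
proof (intro allI impI)
  fix C \<theta> assume C: "C \<subseteq> W" "state C \<theta> \<kappa>" "\<theta> \<noteq> 0" "Q \<theta> = c"
  have "\<exists>t\<in>V. t \<noteq> 0 \<and> t \<noteq> \<rho> \<and> B \<rho> t = (\<not> \<kappa>) \<and> Q t = c"
  proof (cases \<kappa>)
    case True
    then show ?thesis
      using perp_both_values[OF subspace_span V(3), of \<rho> c] by auto
  next
    case False
    obtain t where "t \<in> V" "B \<rho> t" "Q t = c"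
      using common_neighbor[OF subspace_span V(3,1) \<rho>_in_V \<rho>_in_V \<rho>_neq_0 \<rho>_neq_0, of c] by blast
    moreover from this have "t \<noteq> 0" "t \<noteq> \<rho>"
      by auto
    ultimately show ?thesis
      using False by blast
  qed
  then obtain t where t: "t \<in> V" "t \<noteq> 0" "t \<noteq> \<rho>" "B \<rho> t = (\<not> \<kappa>)" "Q t = c"
    by blast
  obtain C1 where C1: "C1 \<subseteq> W" "(lit_move W E)\<^sup>*\<^sup>* C C1" "state C1 t \<kappa>"
    using orbit[OF C(2,1,3) t(1,2)] C(4) t(5) by blast
  have "\<kappa> \<noteq> B t \<rho>"
    using t(4) B_sym by blast
  then obtain C2 where C2: "C2 \<subseteq> W" "(lit_move W E)\<^sup>*\<^sup>* C1 C2" "state C2 (t + \<rho>) \<kappa>"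
    using z_move[OF C1(3,1)] by blast
  have "t + \<rho> \<noteq> 0"
    using t(3) add_eq_0_iff_eq by blast
  moreover have "Q (t + \<rho>) = (\<not> c)"
    using t(4,5) assms(2) B_sym[of t \<rho>] by (auto simp: Q_add)
  ultimately obtain D where "(lit_move W E)\<^sup>*\<^sup>* C2 D" "card D \<le> k"
    using assms(1) C2 unfolding reducible_def by blast
  then show "\<exists>D. (lit_move W E)\<^sup>*\<^sup>* C D \<and> card D \<le> k"
    using C1(2) C2(2) by (meson rtranclp_trans)
qed

text \<open>With \<theta> zero either all lights are off, or \<open>z\<close> is on and its move
  leads to the nonzero state \<rho>.\<close>

lemma k_lit_if_reducible:
  assumes "\<And>c \<kappa>. reducible k c \<kappa>"
  shows "k_lit k W E"
  unfolding k_lit_def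
proof (intro allI impI)
  fix C assume C: "C \<subseteq> W"
  obtain \<theta> \<kappa> where st: "state C \<theta> \<kappa>"
    using exists_state by blast
  consider "\<theta> \<noteq> 0" | "\<theta> = 0" "\<not> \<kappa>" | "\<theta> = 0" "\<kappa>"
    by blast
  then show "\<exists>D. (lit_move W E)\<^sup>*\<^sup>* C D \<and> card D \<le> k"
  proof cases
    case 1
    then show ?thesis
      using assms[of "Q \<theta>" \<kappa>] C st unfolding reducible_def by blast
  next
    case 2
    then have "C = {}"
      using state_unique[OF st _ C, of "{}"] state_empty by simp
    then show ?thesis by auto
  next
    case 3
    then obtain C' where "C' \<subseteq> W" "(lit_move W E)\<^sup>*\<^sup>* C C'" "state C' \<rho> \<kappa>"
      using z_move[OF st C] by (metis B_0(1) add_0)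
    moreover from this obtain D where "(lit_move W E)\<^sup>*\<^sup>* C' D" "card D \<le> k"
      using assms[of "Q \<rho>" \<kappa>] \<rho>_neq_0 unfolding reducible_def by blast
    ultimately show ?thesis
      by (meson rtranclp_trans)
  qed
qed

section \<open>Classes containing one or two lights\<close>

lemma B_\<omega>_\<rho>: "s \<in> S \<Longrightarrow> B (\<omega> s) \<rho> \<longleftrightarrow> (s \<in> alt_set S R P x) \<noteq> (s \<in> alt_set S R P y)"
  using B_\<omega>_\<omega>[of s x] B_\<omega>_\<omega>[of s y] xyS by (auto simp: \<rho>_def B_add_right)

lemma x_in_alt_set: "x \<in> alt_set S R P y \<longleftrightarrow> {x, y} \<in> P" "y \<in> alt_set S R P x \<longleftrightarrow> {x, y} \<in> P"
  "x \<notin> alt_set S R P x" "y \<notin> alt_set S R P y"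
  using alt_set_adjacent[OF tree matching, of y x] alt_set_adjacent[OF tree matching, of x y] xy
    alt_set_subset[OF tree matching]
  by (auto simp: insert_commute)

lemma Q_\<rho>: "Q \<rho> \<longleftrightarrow> ((Q (\<omega> x) \<noteq> Q (\<omega> y)) \<noteq> ({x, y} \<in> P))"
  using B_\<omega>_\<omega>[of x y] xyS x_in_alt_set by (simp add: \<rho>_def Q_add)

lemma reducible_single:
  assumes "s \<in> S" "1 \<le> k"
  shows "reducible k (Q (\<omega> s)) (B (\<omega> s) \<rho>)"
  using reducibleI[OF state_single[OF assms(1)]] assms \<omega>_neq_0[OF assms(1)] by simp

lemma B_\<omega>_x_\<rho>: "B (\<omega> x) \<rho> \<longleftrightarrow> {x, y} \<in> P" and B_\<omega>_y_\<rho>: "B (\<omega> y) \<rho> \<longleftrightarrow> {x, y} \<in> P"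
  using B_\<omega>_\<rho> xyS x_in_alt_set by blast+

lemma reducible_x: "1 \<le> k \<Longrightarrow> reducible k (Q (\<omega> x)) ({x, y} \<in> P)"
  using reducible_single[OF xyS(1)] by (simp only: B_\<omega>_x_\<rho>)

lemma reducible_y: "1 \<le> k \<Longrightarrow> reducible k (Q (\<omega> y)) ({x, y} \<in> P)"
  using reducible_single[OF xyS(2)] by (simp only: B_\<omega>_y_\<rho>)

lemma reducible_z: "1 \<le> k \<Longrightarrow> reducible k (Q (\<omega> x)) ({x, y} \<notin> P)"
  using reducibleI[OF state_z[unfolded B_\<omega>_x_\<rho>]] \<omega>_neq_0[OF xyS(1)] by simp

text \<open>For odd type \<open>x\<close> and \<open>y\<close> cover both values of \<open>Q\<close>
  in one class of \<kappa>. In the other class \<open>z\<close> covers one value, and there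
  \<open>Q \<rho> = \<kappa>\<close>, so the move at \<open>z\<close> merges the two orbits.\<close>

lemma odd_type_1_lit:
  assumes "odd_type S R P x y"
  shows "k_lit 1 W E"
proof (rule k_lit_if_reducible)
  fix c \<kappa>
  have Q: "Q (\<omega> x) \<noteq> Q (\<omega> y)"
    using assms by (auto simp: odd_type_def Q_\<omega>)
  show "reducible 1 c \<kappa>"
  proof (cases "\<kappa> = ({x, y} \<in> P)")
    case True
    then show ?thesis
      using reducible_x[of 1] reducible_y[of 1] Q by (cases "c = Q (\<omega> x)") auto
  next
    case False
    then have z: "reducible 1 (Q (\<omega> x)) \<kappa>" and "Q \<rho> = \<kappa>"
      using reducible_z[of 1] Q Q_\<rho> by auto
    then show ?thesis
      using reducible_merge[of 1 c \<kappa>] by (cases "c = Q (\<omega> x)") auto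
  qed
qed

lemma reducible_pair:
  assumes "s \<in> S" "t \<in> S" "s \<noteq> t" "2 \<le> k"
    "c \<longleftrightarrow> ((Q (\<omega> s) \<noteq> Q (\<omega> t)) \<noteq> (s \<in> alt_set S R P t))" "\<kappa> \<longleftrightarrow> B (\<omega> s) \<rho> \<noteq> B (\<omega> t) \<rho>"
  shows "reducible k c \<kappa>"
proof (rule reducibleI)
  show "state ({s} \<union> {t}) (\<omega> s + \<omega> t) \<kappa>"
    unfolding assms(6) by (rule state_Un[OF state_single state_single]) (use assms in auto)
  show "card ({s} \<union> {t}) \<le> k"
    using assms(3,4) by simp
  have "B (\<omega> s + \<omega> t) (vec s)"
    using B_\<omega>_vec assms(1-3) by (simp add: B_add)
  then show "\<omega> s + \<omega> t \<noteq> 0"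
    by auto
  show "Q (\<omega> s + \<omega> t) = c"
    using assms(5) B_\<omega>_\<omega>[OF assms(1,2)] by (simp add: Q_add)
qed (use assms in auto)

lemma reducible_pair_z:
  assumes "s \<in> S" "s \<noteq> x" "2 \<le> k"
    "c \<longleftrightarrow> ((Q (\<omega> s) \<noteq> Q (\<omega> x)) \<noteq> (s \<in> alt_set S R P x))" "\<kappa> \<longleftrightarrow> (B (\<omega> s) \<rho> = ({x, y} \<in> P))"
  shows "reducible k c \<kappa>"
proof (rule reducibleI)
  have "\<kappa> \<longleftrightarrow> (B (\<omega> s) \<rho> \<noteq> (\<not> B (\<omega> x) \<rho>))"
    using assms(5) B_\<omega>_\<rho>[OF xyS(1)] x_in_alt_set by auto
  then show "state ({s} \<union> {z}) (\<omega> s + \<omega> x) \<kappa>"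
    using state_Un[OF state_single[OF assms(1)] state_z] assms(1) z by auto
  show "card ({s} \<union> {z}) \<le> k"
    using assms z by (simp add: card_insert_if)
  have "B (\<omega> s + \<omega> x) (vec s)"
    using B_\<omega>_vec assms(1,2) xyS by (simp add: B_add)
  then show "\<omega> s + \<omega> x \<noteq> 0"
    by auto
  show "Q (\<omega> s + \<omega> x) = c"
    using assms(4) B_\<omega>_\<omega>[OF assms(1) xyS(1)] by (simp add: Q_add)
qed (use assms in auto)

text \<open>For even type the merging happens in the class of \<open>x\<close>, where one light
  suffices. In the other class \<open>z\<close> covers the value \<open>Q (\<omega> x)\<close>; the
  opposite value may need a second light.\<close>

lemma even_type_2_lit:
  assumes even: "even_type S R P x y"
    and branch: "\<exists>s. s \<noteq> x \<and> s \<noteq> y \<and> ({s, x} \<in> R \<or> {s, y} \<in> R)"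
  shows "k_lit 2 W E"
proof (rule k_lit_if_reducible)
  fix c \<kappa>
  have Q: "Q (\<omega> x) \<longleftrightarrow> Q (\<omega> y)"
    using even by (auto simp: even_type_def Q_\<omega>)
  consider "\<kappa> = ({x, y} \<in> P)" | "\<kappa> = ({x, y} \<notin> P)" "c = Q (\<omega> x)"
    | "\<kappa> = ({x, y} \<notin> P)" "c = (\<not> Q (\<omega> x))" "{x, y} \<in> P"
    | "\<kappa> = ({x, y} \<notin> P)" "c = (\<not> Q (\<omega> x))" "{x, y} \<notin> P"
    by blast
  then show "reducible 2 c \<kappa>"
  proof cases
    case 1
    then have "Q \<rho> = \<kappa>" "reducible 2 (Q (\<omega> x)) \<kappa>"
      using Q Q_\<rho> reducible_x[of 2] by auto
    then show ?thesis
      using reducible_merge[of 2 c \<kappa>] by (cases "c = Q (\<omega> x)") auto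
  next
    case 2
    then show ?thesis
      using reducible_z[of 2] by simp
  next
    case 3
    show ?thesis
    proof (cases c)
      case True
      then show ?thesis
        using 3 Q xyS B_\<omega>_\<rho> x_in_alt_set by (intro reducible_pair[of x y]) auto
    next
      case False
      \<comment> \<open>A neighbor of the edge \<open>xy\<close> lies in neither \<open>A_x\<close>
        nor \<open>A_y\<close>: it is partner of neither end, and distance two is excluded.
        Depending on \<open>Q (\<omega> s)\<close>, the lights are \<open>s\<close> and
        \<open>z\<close> or \<open>s\<close> alone.\<close>
      obtain s where s: "s \<noteq> x" "s \<noteq> y" "{s, x} \<in> R \<or> {s, y} \<in> R"
        using branch by blast
      have "s \<in> S"
        using s(3) edge_in[OF tree] by blast
      have "{x, s} \<notin> P" "{y, s} \<notin> P"
        using matching_unique[OF tree matching, of x y s] matching_unique[OF tree matching, of y x s] 3(3) s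
        by (auto simp: insert_commute)
      then have nA: "s \<notin> alt_set S R P x" "s \<notin> alt_set S R P y"
        using s(3) alt_set_adjacent[OF tree matching, of x s] alt_set_adjacent[OF tree matching, of y s]
          alt_set_distance_2[OF tree matching, of x y s] alt_set_distance_2[OF tree matching, of y x s] s xy
        by (auto simp: insert_commute)
      then have "\<not> B (\<omega> s) \<rho>"
        using B_\<omega>_\<rho>[OF \<open>s \<in> S\<close>] by simp
      show ?thesis
      proof (cases "Q (\<omega> s)")
        case True
        then show ?thesis
          using 3 False nA \<open>\<not> B (\<omega> s) \<rho>\<close> s \<open>s \<in> S\<close> by (intro reducible_pair_z[of s]) auto
      next
        case notQ: False
        then show ?thesis
          using reducible_single[OF \<open>s \<in> S\<close>, of 2] 3 False \<open>\<not> B (\<omega> s) \<rho>\<close> by simp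
      qed
    qed
  next
    case 4
    show ?thesis
    proof (cases c)
      case False
      then show ?thesis
        using 4 Q xyS B_\<omega>_\<rho> x_in_alt_set by (intro reducible_pair_z[of y]) auto
    next
      case True
      \<comment> \<open>The partner of \<open>x\<close> lies in \<open>A_x\<close> but not in
        \<open>A_y\<close>. Either it alone or together with \<open>x\<close> has the required
        state.\<close>
      obtain s where s: "{x, s} \<in> P"
        using partner_exists[OF tree matching xyS(1)] .
      have "{x, s} \<in> R" "s \<in> S" "s \<noteq> x" "s \<noteq> y"
        using s matching_edge[OF tree matching s] edge_in[OF tree, of x s] 4(3) by auto
      then have A: "s \<in> alt_set S R P x" "s \<notin> alt_set S R P y"
        using s alt_set_adjacent[OF tree matching, of x s] alt_set_distance_2[OF tree matching, of y x s] xy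
        by (auto simp: insert_commute)
      then have "B (\<omega> s) \<rho>" "\<not> B (\<omega> x) \<rho>"
        using B_\<omega>_\<rho>[OF \<open>s \<in> S\<close>] B_\<omega>_\<rho>[OF xyS(1)] 4(3) x_in_alt_set by auto
      show ?thesis
      proof (cases "Q (\<omega> s)")
        case True
        then show ?thesis
          using reducible_single[OF \<open>s \<in> S\<close>, of 2] 4 \<open>c\<close> \<open>B (\<omega> s) \<rho>\<close> by simp
      next
        case False
        then show ?thesis
          using 4 \<open>c\<close> A \<open>B (\<omega> s) \<rho>\<close> \<open>\<not> B (\<omega> x) \<rho>\<close> \<open>s \<in> S\<close> \<open>s \<noteq> x\<close> xyS
          by (intro reducible_pair[of s x]) auto
      qed
    qed
  qed
qed

end

section \<open>Growing the tree along its matching\<close>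

context subdivided_tree
begin

definition matched :: "'a set \<Rightarrow> bool" where
  "matched T \<longleftrightarrow> connected_in R T \<and> T \<subseteq> S \<and> (\<forall>t\<in>T. \<forall>w. {t, w} \<in> P \<longrightarrow> w \<in> T)"

text \<open>Acyclicity leaves \<open>p\<close> with the single neighbor \<open>u\<close> in the
  subtree; applied to the subtree enlarged by \<open>p\<close>, it leaves \<open>q\<close> with none
  in \<open>T\<close>.\<close>

lemma attach_matching_edge:
  assumes T: "matched T" and u: "u \<in> T" "{u, p} \<in> R" and pq: "p \<notin> T" "{p, q} \<in> P"
  shows "matched (insert p (insert q T))" "p \<in> S" "q \<in> S" "q \<notin> T" "p \<noteq> q"
    and "t \<in> T \<Longrightarrow> {p, t} \<in> R \<longleftrightarrow> t = u" "t \<in> T \<Longrightarrow> {q, t} \<notin> R"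
proof -
  note T' = T[unfolded matched_def]
  have pqR: "{p, q} \<in> R"
    using matching_edge[OF tree matching pq(2)] .
  then show S: "p \<in> S" "q \<in> S" "p \<noteq> q"
    using edge_in[OF tree] by blast+
  have qp: "{q, p} \<in> P"
    using pq(2) by (simp add: insert_commute)
  then show qT: "q \<notin> T"
    using T' pq(1) by blast
  have conn: "connected_in R (insert p T)"
    using connected_in_insert[OF tree _ u pq(1)] T' by blast
  then have "connected_in R (insert q (insert p T))"
    using connected_in_insert[OF tree conn, of p q] pqR qT S by blast
  then have "connected_in R (insert p (insert q T))"
    by (simp add: insert_commute)
  moreover have "w \<in> insert p (insert q T)" if "t \<in> insert p (insert q T)" "{t, w} \<in> P" for t w
    using that matching_unique[OF tree matching pq(2), of w] matching_unique[OF tree matching qp, of w] T'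
    by blast
  ultimately show "matched (insert p (insert q T))"
    using T' S unfolding matched_def by blast
  show "{p, t} \<in> R \<longleftrightarrow> t = u" if "t \<in> T"
    using unique_neighbor[OF tree _ _ pq(1) u(1) that u(2)] T' u(2) by (auto simp: insert_commute)
  show "{q, t} \<notin> R" if "t \<in> T"
  proof
    assume "{q, t} \<in> R"
    then have "{t, q} \<in> R"
      by (simp add: insert_commute)
    moreover have "insert p T \<subseteq> S" "q \<notin> insert p T" "t \<in> insert p T"
      using T' S qT that by auto
    ultimately have "p = t"
      using unique_neighbor[OF tree conn, of q p t] pqR by blast
    then show False
      using that pq(1) by blast
  qed
qed

lemma full_attach:
  assumes T: "matched T" "full (vec ` T)" and u: "u \<in> T" "{u, p} \<in> R" and pq: "p \<notin> T" "{p, q} \<in> P"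
  shows "full (vec ` insert p (insert q T))"
proof -
  note a = attach_matching_edge[OF T(1) u pq]
  have TS: "T \<subseteq> S"
    using T(1) by (simp add: matched_def)
  have "B (vec p) (vec q)"
    using matching_edge[OF tree matching pq(2)] B_vec[OF a(2,3)] by blast
  moreover have "B (vec p) (vec u)"
    using a(6)[OF u(1)] B_vec[OF a(2), of u] u(1) TS by blast
  moreover have "\<not> B (vec q) g" if g: "g \<in> vec ` T" for g
  proof -
    obtain t where "t \<in> T" "g = vec t"
      using g by blast
    then show ?thesis
      using a(7)[of t] B_vec[OF a(3), of t] TS by blast
  qed
  ultimately have "full (insert (vec p) (insert (vec q) (vec ` T)))"
    using a(2,3) u(1) by (intro full_extension[OF T(2), where u = "vec u"]) (simp_all add: Q_vec vec_root)
  then show ?thesis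
    by simp
qed

text \<open>While \<open>T\<close> is not everything, connectedness gives an edge leaving it. The
  partner of its outer end is also outside, and both are attached.\<close>

lemma full_grow:
  assumes "matched T" "full (vec ` T)" "T \<noteq> {}"
  shows "full (vec ` S)"
  using assms
proof (induction "card (S - T)" arbitrary: T rule: less_induct)
  case less
  have TS: "T \<subseteq> S"
    using less.prems(1) by (simp add: matched_def)
  show ?case
  proof (cases "T = S")
    case True
    then show ?thesis using less.prems(2) by simp
  next
    case False
    then obtain r v where rv: "r \<in> T" "v \<in> S" "v \<notin> T"
      using less.prems(3) TS by blast
    then obtain l where "joining_path S R r l v"
      using tree_connected[OF tree, of r v] TS by blast
    then have l: "successively (\<lambda>a b. {a, b} \<in> R) l" "l \<noteq> []" "hd l \<in> T" "last l \<notin> T"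
      using rv by (simp_all add: joining_path_iff)
    obtain u p where up: "u \<in> T" "p \<notin> T" "{u, p} \<in> R"
      using leaving_edge[OF l] by blast
    then have "p \<in> S"
      using edge_in[OF tree] by blast
    obtain q where q: "{p, q} \<in> P"
      using partner_exists[OF tree matching \<open>p \<in> S\<close>] .
    have "S - insert p (insert q T) \<subset> S - T"
      using up(2) \<open>p \<in> S\<close> by blast
    then have "card (S - insert p (insert q T)) < card (S - T)"
      using finite_S by (intro psubset_card_mono) auto
    then show ?thesis
      using less.hyps attach_matching_edge(1)[OF less.prems(1) up(1,3,2) q]
        full_attach[OF less.prems(1,2) up(1,3,2) q] by blast
  qed
qed

text \<open>The branch vertex \<open>c\<close>, its partner \<open>c'\<close>, two further neighbors
  \<open>b\<close> and \<open>p\<close> and their partners \<open>a\<close> and \<open>q\<close>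
  induce a diagram of type E6, from which the tree is grown.\<close>

lemma full_if_branching:
  assumes d: "{c, d\<^sub>1} \<in> R" "{c, d\<^sub>2} \<in> R" "{c, d\<^sub>3} \<in> R" "d\<^sub>1 \<noteq> d\<^sub>2" "d\<^sub>1 \<noteq> d\<^sub>3" "d\<^sub>2 \<noteq> d\<^sub>3"
  shows "full (vec ` S)"
proof -
  have cS: "c \<in> S"
    using edge_in[OF tree d(1)] by blast
  obtain c' where c': "{c, c'} \<in> P"
    using partner_exists[OF tree matching cS] .
  have cR: "{c, c'} \<in> R"
    using matching_edge[OF tree matching c'] .
  then have "c' \<in> S" "c \<noteq> c'"
    using edge_in[OF tree] by blast+
  \<comment> \<open>At most one of the three neighbors is \<open>c'\<close>, so two others
    remain.\<close>
  obtain b p where bp: "{c, b} \<in> R" "{c, p} \<in> R" "b \<noteq> p" "b \<noteq> c'" "p \<noteq> c'"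
    using d by metis
  have bp': "b \<noteq> c" "p \<noteq> c" "b \<in> S" "p \<in> S"
    using edge_in[OF tree] bp by blast+
  obtain a where a: "{b, a} \<in> P"
    using partner_exists[OF tree matching bp'(3)] .
  obtain q where q: "{p, q} \<in> P"
    using partner_exists[OF tree matching bp'(4)] .
  have "joining_path {c} R c [c] c"
    by (simp add: joining_path_iff)
  then have "connected_in R {c}"
    unfolding connected_in_def[OF tree] by blast
  then have "connected_in R {c', c}"
    using connected_in_insert[OF tree, of "{c}" c c'] cR \<open>c \<noteq> c'\<close> by blast
  moreover have "{c', c} \<in> P"
    using c' by (simp add: insert_commute)
  then have "w \<in> {c', c}" if "t \<in> {c', c}" "{t, w} \<in> P" for t w
    using that c' matching_unique[OF tree matching] by blast
  ultimately have m2: "matched {c', c}"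
    using cS \<open>c' \<in> S\<close> unfolding matched_def by blast
  have bT: "b \<notin> {c', c}"
    using bp(4) bp'(1) by blast
  note A = attach_matching_edge[OF m2 _ bp(1) bT a, simplified]
  have ap: "a \<noteq> p"
  proof
    assume "a = p"
    then have "{b, p} \<in> R"
      using matching_edge[OF tree matching a] by simp
    then show False
      using A(7)[of c] bp(2) \<open>a = p\<close> by (simp add: insert_commute)
  qed
  have pT: "p \<notin> {b, a, c', c}"
    using bp bp' ap by blast
  note C = attach_matching_edge[OF A(1) _ bp(2) pT q, simplified]
  have S6: "a \<in> S" "b \<in> S" "c \<in> S" "c' \<in> S" "p \<in> S" "q \<in> S"
    using A(2,3) C(2,3) cS \<open>c' \<in> S\<close> by blast+
  have ab: "{a, b} \<in> R" and bc: "{b, c} \<in> R" and cp: "{c, p} \<in> R" and pq: "{p, q} \<in> R"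
    using matching_edge[OF tree matching a] matching_edge[OF tree matching q] bp(1,2)
    by (simp_all add: insert_commute)
  have n: "{a, c} \<notin> R" "{a, c'} \<notin> R" "{a, p} \<notin> R" "{a, q} \<notin> R" "{b, c'} \<notin> R" "{b, p} \<notin> R" "{b, q} \<notin> R"
    "{c, q} \<notin> R" "{c', p} \<notin> R" "{c', q} \<notin> R"
    using A(4,5) A(6)[of c'] A(7)[of c] A(7)[of c'] C(6)[of a] C(6)[of b] C(6)[of c'] C(7)[of a] C(7)[of b]
      C(7)[of c] C(7)[of c'] bT \<open>c \<noteq> c'\<close>
    by (auto simp: insert_commute)
  have "full {vec p, vec q, vec a, vec b, vec c, vec c'}"
    by (rule full_E6) (use S6 ab bc cR cp pq n in \<open>auto simp: Q_vec B_vec vec_root\<close>)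
  then have "full (vec ` insert p (insert q {b, a, c', c}))"
    by (simp add: insert_commute)
  moreover have "matched (insert p (insert q {b, a, c', c}))"
    using C(1) by blast
  ultimately show ?thesis
    using full_grow by blast
qed

end

theorem theorem1p2:
  fixes S :: "'a set" and R P :: "'a set set" and x y z :: 'a
  assumes "finite_tree S R"
    and "perfect_matching S R P"
    and "{x, y} \<in> R"
    and "z \<notin> S"
  shows "(odd_type S R P x y \<longrightarrow>
            k_lit 1 (insert z S) ((R - {{x, y}}) \<union> {{x, z}, {y, z}})) \<and>
         (even_type S R P x y \<longrightarrow>
            k_lit 2 (insert z S) ((R - {{x, y}}) \<union> {{x, z}, {y, z}}))"
proof -
  interpret subdivided_tree S R P x y z
    using assms by unfold_locales
  show ?thesis
  proof (rule path_or_branching[OF assms(1)])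
    fix l assume l: "distinct l" "S = set l" "R = set (path_edges l)"
    have "k_lit 1 (insert z S) ((R - {{x, y}}) \<union> {{x, z}, {y, z}})"
      using subdivided_path_one_lit[of l z x y] l assms(3,4) by simp
    then show ?thesis
      unfolding k_lit_def by (meson le_trans one_le_numeral)
  next
    fix c d1 d2 d3
    assume d: "{c, d1} \<in> R" "{c, d2} \<in> R" "{c, d3} \<in> R" "d1 \<noteq> d2" "d1 \<noteq> d3" "d2 \<noteq> d3"
    interpret branching_subdivided_tree S R P x y z
      by unfold_locales (rule full_if_branching[OF d])
    \<comment> \<open>Some vertex lies off the edge \<open>xy\<close>; the path to it from
      \<open>x\<close> leaves that edge and supplies the extra neighbor for the even case.\<close>
    obtain v where v: "v \<in> S" "v \<notin> {x, y}"
      using edge_in[OF assms(1)] d by (metis empty_iff insert_iff)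
    obtain l where "joining_path S R x l v"
      using tree_connected[OF assms(1) xyS(1) v(1)] by blast
    then have "successively (\<lambda>a b. {a, b} \<in> R) l" "l \<noteq> []" "hd l \<in> {x, y}" "last l \<notin> {x, y}"
      using v(2) by (simp_all add: joining_path_iff)
    from leaving_edge[OF this] have "\<exists>s. s \<noteq> x \<and> s \<noteq> y \<and> ({s, x} \<in> R \<or> {s, y} \<in> R)"
      by (auto simp: insert_commute)
    then show ?thesis
      using odd_type_1_lit even_type_2_lit unfolding E_def by blast
  qed
qed

end
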